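(* Let $L>N$ be positive integers, let $0<|z|<\mathbf r_{N,L}$, and let $r_{1,N,L}(z):=\max_{v\in\mathcal R_z}|v|$ and $r_{2,N,L}(z):=\max_{u\in\mathcal L_z}|u+1|$. Let $Y\in\mathrm{Pconf}_{N,L}$, and let $\rho\in(0,1)$ satisfy $$r_{1,N,L}(z)<\rho<1-r_{2,N,L}(z),\qquad\rho^N(1-\rho)^{L-N}>|z|^L.$$ Assume that $\mathcal E_Y(z)\ne0$. Then, for every $v\in\mathcal R_z$ and every $u\in\mathbb C$ satisfying $0<|u+1|<1-\rho$, $$\mathrm{pch}^{\mathrm{norm}}_Y(v,u;z)=\mathrm{pch}_Y(v,u),$$ where $\mathrm{pch}_Y$ is defined using the geometric random walk with parameter $\rho$.
   Context: **Configurations.** $\mathrm{Pconf}_{N,L}$ is the set of $Y=(y_i)_{i\in\mathbb Z}$ with $y_i\in\mathbb Z$, $y_{i+1}<y_i$ and $y_{i+N}=y_i-L$ for all $i\in\mathbb Z$. **Bethe roots.** $q_z(w):=w^N(w+1)^{L-N}-z^L$ and $\mathbf r_{N,L}:=(N/L)^{N/L}(1-N/L)^{1-N/L}$. For $0<|z|<\mathbf r_{N,L}$, $\mathcal L_z:=\{w:q_z(w)=0,\mathrm{Re}\,w<-N/L\}$ ($L-N$ elements), $\mathcal R_z:=\{w:q_z(w)=0,\mathrm{Re}\,w>-N/L\}$ ($N$ elements), $q_{z,\mathrm L}(w):=\prod_{u\in\mathcal L_z}(w-u)$, $q_{z,\mathrm R}(w):=\prod_{v\in\mathcal R_z}(w-v)$.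 **Algebraic functions.** For $W=(w_1,\dots,w_N)$ let $\mathfrak G_Y(W):=\det[w_i^{-j}(w_i+1)^{y_j+j}]_{i,j=1}^N/\det[w_i^{-j}]_{i,j=1}^N$, which is symmetric in the $w_i$ so that $W$ may be regarded as a set. Set $\mathcal E_Y(z):=\mathfrak G_Y(\mathcal R_z)$ and, if $\mathcal E_Y(z)\ne0$, for $v\in\mathcal R_z$ and $u\in\mathbb C\setminus\{-1,0,v\}$, $$\mathrm{pch}^{\mathrm{mod}}_Y(v,u;z):=\frac{\mathfrak G_Y(\mathcal R_z\cup\{u\}\setminus\{v\})}{(v-u)\,\mathfrak G_Y(\mathcal R_z)},\qquad\mathrm{pch}^{\mathrm{norm}}_Y(v,u;z):=\frac{q_{z,\mathrm L}(v)\,q_{z,\mathrm R}(u)}{u^N(v+1)^{L-N}}\,\mathrm{pch}^{\mathrm{mod}}_Y(v,u;z).$$ **Probabilistic function.** Let $(G_k)_{k\ge0}$ be the random walk with transition probabilities $\mathbb P(G_{k+1}=b\mid G_k=a)=\frac{\rho}{1-\rho}(1-\rho)^{a-b}\mathbf 1_{b-a\in\{-1,-2,\dots\}}$. Let $\tau:=\inf\{m\ge0:G_m>y_{m+1}\}$ and $\tau^*:=\inf\{m\ge N:G_m>y_{m+1}\}$. Define $$\mathrm{ch}_Y(v,u):=\sum_{x\in\mathbb Z}\Bigl(\frac{u+1}{1-\rho}\Bigr)^x\mathbb E_{G_0=x}\Bigl[\frac{(1-\rho)^{G_\tau}}{(v+1)^{G_\tau+1}}\Bigl(\frac{-v(1-\rho)}{(v+1)\rho}\Bigr)^\tau\mathbf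 1_{\tau<N}\Bigr],$$ $$\mathrm{ch}^*_Y(v,u):=\sum_{x\in\mathbb Z}\Bigl(\frac{u+1}{1-\rho}\Bigr)^x\mathbb E_{G_0=x}\Bigl[\frac{(1-\rho)^{G_{\tau^*}}}{(v+1)^{G_{\tau^*}+1}}\Bigl(\frac{-v(1-\rho)}{(v+1)\rho}\Bigr)^{\tau^*}\mathbf 1_{\tau<N,\,\tau^*<\infty}\Bigr],$$ and $\mathrm{pch}_Y(v,u):=\mathrm{ch}_Y(v,u)-\mathrm{ch}_Y^*(v,u)$. *)

theory Defs
  imports
    "HOL-Probability.Probability"
    "Jordan_Normal_Form.Determinant"
begin

section \<open>Configurations\<close>

definition Pconf :: "nat \<Rightarrow> nat \<Rightarrow> (int \<Rightarrow> int) set" where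
  "Pconf N L = {Y. \<forall>i. Y (i + 1) < Y i \<and> Y (i + int N) = Y i - int L}"


section \<open>Bethe roots\<close>

definition qz :: "nat \<Rightarrow> nat \<Rightarrow> complex \<Rightarrow> complex \<Rightarrow> complex" where
  "qz N L z w = w ^ N * (w + 1) ^ (L - N) - z ^ L"

definition rNL :: "nat \<Rightarrow> nat \<Rightarrow> real" where
  "rNL N L = (real N / real L) powr (real N / real L)
               * (1 - real N / real L) powr (1 - real N / real L)"

definition left_roots :: "nat \<Rightarrow> nat \<Rightarrow> complex \<Rightarrow> complex set" where
  "left_roots N L z = {w. qz N L z w = 0 \<and> Re w < - (real N / real L)}"

definition right_roots :: "nat \<Rightarrow> nat \<Rightarrow> complex \<Rightarrow> complex set" where
  "right_roots N L z = {w. qz N L z w = 0 \<and> Re w > - (real N / real L)}"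

definition qzL :: "nat \<Rightarrow> nat \<Rightarrow> complex \<Rightarrow> complex \<Rightarrow> complex" where
  "qzL N L z w = (\<Prod>u\<in>left_roots N L z. w - u)"

definition qzR :: "nat \<Rightarrow> nat \<Rightarrow> complex \<Rightarrow> complex \<Rightarrow> complex" where
  "qzR N L z w = (\<Prod>v\<in>right_roots N L z. w - v)"

definition r1 :: "nat \<Rightarrow> nat \<Rightarrow> complex \<Rightarrow> real" where
  "r1 N L z = Max ((\<lambda>v. cmod v) ` right_roots N L z)"

definition r2 :: "nat \<Rightarrow> nat \<Rightarrow> complex \<Rightarrow> real" where
  "r2 N L z = Max ((\<lambda>u. cmod (u + 1)) ` left_roots N L z)"


section \<open>Algebraic functions\<close>

text \<open>Matrix and list indices start at 0, so row \<open>i\<close> is the variable with number \<open>i + 1\<close>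
  and column \<open>j\<close> carries the exponents belonging to \<open>j + 1\<close>. The number of variables
  is the length of the list.\<close>

definition GY_list :: "(int \<Rightarrow> int) \<Rightarrow> complex list \<Rightarrow> complex" where
  "GY_list Y ws =
     Determinant.det (Matrix.mat (length ws) (length ws) (\<lambda>(i, j).
        (ws ! i) powi (- (int j + 1)) * (ws ! i + 1) powi (Y (int j + 1) + (int j + 1))))
     / Determinant.det (Matrix.mat (length ws) (length ws) (\<lambda>(i, j).
        (ws ! i) powi (- (int j + 1))))"

text \<open>On a finite set the value is that of any enumeration without repetition;
  see \<open>GY_set\<close> for the independence of the enumeration.\<close>

definition GY :: "(int \<Rightarrow> int) \<Rightarrow> complex set \<Rightarrow> complex" where
  "GY Y W = GY_list Y (SOME ws. distinct ws \<and> set ws = W)"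

lemma GY_list_permute:
  assumes "p permutes {..<length ws}"
  shows "GY_list Y (permute_list p ws) = GY_list Y ws"
proof -
  let ?n = "length ws"
  have p: "p permutes {0..<?n}"
    using assms by (simp add: atLeast0LessThan)
  have lt: "p i < ?n" if "i < ?n" for i
    using permutes_in_image[OF assms, of i] that by simp
  have perm: "Determinant.det (Matrix.mat ?n ?n (\<lambda>(i, j). f (permute_list p ws ! i) j))
      = signof p * Determinant.det (Matrix.mat ?n ?n (\<lambda>(i, j). f (ws ! i) j))"
    for f :: "complex \<Rightarrow> nat \<Rightarrow> complex"
  proof -
    let ?A = "Matrix.mat ?n ?n (\<lambda>(i, j). f (ws ! i) j)"
    have "Matrix.mat ?n ?n (\<lambda>(i, j). f (permute_list p ws ! i) j)
        = Matrix.mat ?n ?n (\<lambda>(i, j). ?A $$ (p i, j))"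
      by (rule eq_matI) (use lt in \<open>simp_all add: permute_list_nth[OF assms]\<close>)
    then show ?thesis
      using det_permute_rows[OF _ p, of ?A] by simp
  qed
  have "signof p \<noteq> (0 :: complex)"
    by (simp add: sign_def)
  then show ?thesis
    unfolding GY_list_def length_permute_list
      perm[of "\<lambda>w j. w powi (- (int j + 1)) * (w + 1) powi (Y (int j + 1) + (int j + 1))"]
      perm[of "\<lambda>w j. w powi (- (int j + 1))"]
    by simp
qed

lemma GY_set:
  assumes "distinct ws"
  shows "GY Y (set ws) = GY_list Y ws"
proof -
  define vs where "vs = (SOME vs. distinct vs \<and> set vs = set ws)"
  have "distinct vs \<and> set vs = set ws"
    unfolding vs_def by (rule someI[of _ ws]) (use assms in simp)
  then have "mset vs = mset ws"
    using assms set_eq_iff_mset_eq_distinct[of vs ws] by simp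
  then obtain p where "p permutes {..<length ws}" "permute_list p ws = vs"
    by (rule mset_eq_permutation)
  then show ?thesis
    using GY_list_permute[of p ws Y] by (simp add: GY_def vs_def)
qed

definition EY :: "nat \<Rightarrow> nat \<Rightarrow> (int \<Rightarrow> int) \<Rightarrow> complex \<Rightarrow> complex" where
  "EY N L Y z = GY Y (right_roots N L z)"

definition pch_mod ::
    "nat \<Rightarrow> nat \<Rightarrow> (int \<Rightarrow> int) \<Rightarrow> complex \<Rightarrow> complex \<Rightarrow> complex \<Rightarrow> complex" where
  "pch_mod N L Y v u z =
     GY Y (right_roots N L z \<union> {u} - {v}) / ((v - u) * GY Y (right_roots N L z))"

definition pch_norm ::
    "nat \<Rightarrow> nat \<Rightarrow> (int \<Rightarrow> int) \<Rightarrow> complex \<Rightarrow> complex \<Rightarrow> complex \<Rightarrow> complex" where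
  "pch_norm N L Y v u z =
     qzL N L z v * qzR N L z u / (u ^ N * (v + 1) ^ (L - N)) * pch_mod N L Y v u z"


section \<open>Geometric random walk\<close>

text \<open>The walk started at \<open>x\<close> is realised on the product space of its independent increments;
  \<open>walk_law\<close> confirms that it is the Markov chain with the transition probabilities
  \<open>walk_trans\<close>.\<close>

definition walk_trans :: "real \<Rightarrow> int \<Rightarrow> int \<Rightarrow> real" where
  "walk_trans \<rho> a b = (if b - a \<le> -1 then \<rho> / (1 - \<rho>) * (1 - \<rho>) powi (a - b) else 0)"

definition walk_step :: "real \<Rightarrow> int pmf" where
  "walk_step \<rho> = map_pmf (\<lambda>n. - 1 - int n) (geometric_pmf \<rho>)"

definition walk_space :: "real \<Rightarrow> (nat \<Rightarrow> int) measure" where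
  "walk_space \<rho> = PiM UNIV (\<lambda>_. measure_pmf (walk_step \<rho>))"

definition walk :: "int \<Rightarrow> (nat \<Rightarrow> int) \<Rightarrow> nat \<Rightarrow> int" where
  "walk x \<omega> k = x + (\<Sum>i<k. \<omega> i)"

lemma pmf_walk_step:
  assumes "0 < \<rho>" "\<rho> < 1"
  shows "pmf (walk_step \<rho>) (b - a) = walk_trans \<rho> a b"
proof (cases "b - a \<le> -1")
  case True
  define n where "n = nat (a - b - 1)"
  have n: "b - a = - 1 - int n" "a - b = int (Suc n)"
    using True by (simp_all add: n_def)
  have "pmf (walk_step \<rho>) (b - a) = pmf (geometric_pmf \<rho>) n"
    unfolding walk_step_def n(1) by (rule pmf_map_inj') (simp add: inj_def)
  then show ?thesis
    using True assms unfolding walk_trans_def n(2) power_int_of_nat by simp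
next
  case False
  then have "b - a \<notin> set_pmf (walk_step \<rho>)"
    by (auto simp: walk_step_def)
  then show ?thesis
    using False by (simp add: walk_trans_def set_pmf_iff)
qed

lemma walk_law:
  assumes "0 < \<rho>" "\<rho> < 1"
  shows "measure (walk_space \<rho>) {\<omega>. \<forall>i\<le>n. walk x \<omega> i = g i}
       = (if g 0 = x then \<Prod>i<n. walk_trans \<rho> (g i) (g (Suc i)) else 0)"
proof (cases "g 0 = x")
  case False
  then have "{\<omega>. \<forall>i\<le>n. walk x \<omega> i = g i} = {}"
    by (auto simp: walk_def)
  then show ?thesis
    using False by (simp only: measure_empty if_False)
next
  case True
  interpret product_prob_space "\<lambda>_::nat. measure_pmf (walk_step \<rho>)" UNIV
    by standard
  have "(\<forall>i\<le>n. walk x \<omega> i = g i) \<longleftrightarrow> (\<forall>i<n. \<omega> i = g (Suc i) - g i)" for \<omega>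
  proof (induction n)
    case 0
    then show ?case using True by (simp add: walk_def)
  next
    case (Suc n)
    have s: "walk x \<omega> (Suc n) = walk x \<omega> n + \<omega> n"
      by (simp add: walk_def)
    have "(\<forall>i\<le>Suc n. walk x \<omega> i = g i)
        \<longleftrightarrow> (\<forall>i\<le>n. walk x \<omega> i = g i) \<and> walk x \<omega> (Suc n) = g (Suc n)"
      by (auto simp: le_Suc_eq)
    also have "\<dots> \<longleftrightarrow> (\<forall>i\<le>n. walk x \<omega> i = g i) \<and> \<omega> n = g (Suc n) - g n"
      unfolding s by (smt (verit) le_refl)
    finally have "(\<forall>i\<le>Suc n. walk x \<omega> i = g i)
        \<longleftrightarrow> (\<forall>i\<le>n. walk x \<omega> i = g i) \<and> \<omega> n = g (Suc n) - g n" .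
    then show ?case
      using Suc.IH by (auto simp: less_Suc_eq)
  qed
  then have "{\<omega>. \<forall>i\<le>n. walk x \<omega> i = g i}
      = prod_emb UNIV (\<lambda>_. measure_pmf (walk_step \<rho>)) {..<n}
          (\<Pi>\<^sub>E i\<in>{..<n}. {g (Suc i) - g i})"
    by (auto simp: prod_emb_def PiE_iff)
  then have "measure (walk_space \<rho>) {\<omega>. \<forall>i\<le>n. walk x \<omega> i = g i}
      = (\<Prod>i<n. measure (measure_pmf (walk_step \<rho>)) {g (Suc i) - g i})"
    unfolding walk_space_def by (simp add: measure_PiM_emb)
  also have "\<dots> = (\<Prod>i<n. walk_trans \<rho> (g i) (g (Suc i)))"
    using pmf_walk_step[OF assms] by (simp add: measure_pmf_single)
  finally show ?thesis
    using True by simp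
qed


section \<open>Probabilistic functions\<close>

text \<open>First time \<open>m \<ge> n\<close> at which the path \<open>G\<close> is above \<open>Y (m + 1)\<close>, and \<open>\<infinity>\<close> if there is
  none: the stopping times of the two expectations are the cases \<open>n = 0\<close> and \<open>n = N\<close>.\<close>

definition hit_time :: "(int \<Rightarrow> int) \<Rightarrow> nat \<Rightarrow> (nat \<Rightarrow> int) \<Rightarrow> enat" where
  "hit_time Y n G = Inf (enat ` {m. n \<le> m \<and> G m > Y (int m + 1)})"

definition ch_weight :: "real \<Rightarrow> complex \<Rightarrow> (nat \<Rightarrow> int) \<Rightarrow> nat \<Rightarrow> complex" where
  "ch_weight \<rho> v G t =
     of_real (1 - \<rho>) powi (G t) / (v + 1) powi (G t + 1)
       * (- v * of_real (1 - \<rho>) / ((v + 1) * of_real \<rho>)) ^ t"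

definition ch :: "nat \<Rightarrow> (int \<Rightarrow> int) \<Rightarrow> real \<Rightarrow> complex \<Rightarrow> complex \<Rightarrow> complex" where
  "ch N Y \<rho> v u = (\<Sum>\<^sub>\<infinity>x\<in>UNIV. ((u + 1) / of_real (1 - \<rho>)) powi x *
     (LINT \<omega>|walk_space \<rho>.
        (let G = walk x \<omega>; \<tau> = hit_time Y 0 G
         in if \<tau> < enat N then ch_weight \<rho> v G (the_enat \<tau>) else 0)))"

definition ch_star :: "nat \<Rightarrow> (int \<Rightarrow> int) \<Rightarrow> real \<Rightarrow> complex \<Rightarrow> complex \<Rightarrow> complex" where
  "ch_star N Y \<rho> v u = (\<Sum>\<^sub>\<infinity>x\<in>UNIV. ((u + 1) / of_real (1 - \<rho>)) powi x *
     (LINT \<omega>|walk_space \<rho>.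
        (let G = walk x \<omega>; \<tau> = hit_time Y 0 G; \<tau>' = hit_time Y N G
         in if \<tau> < enat N \<and> \<tau>' < \<infinity> then ch_weight \<rho> v G (the_enat \<tau>') else 0)))"

definition pch :: "nat \<Rightarrow> (int \<Rightarrow> int) \<Rightarrow> real \<Rightarrow> complex \<Rightarrow> complex \<Rightarrow> complex" where
  "pch N Y \<rho> v u = ch N Y \<rho> v u - ch_star N Y \<rho> v u"

end

theory Submission
  imports Defs "HOL-Complex_Analysis.Complex_Analysis"
    "HOL-Computational_Algebra.Fundamental_Theorem_Algebra"
begin

text \<open>Let \<open>P\<close> be the transition operator of the walk, \<open>w k x\<close> the value of the weight at time \<open>k\<close>
  and position \<open>x\<close>, and \<open>h k x\<close> its mean at the first hit when the walk is started at time \<open>k\<close>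
  in \<open>x\<close>. Then \<open>h k = w k\<close> above \<open>a k = Y (k + 1)\<close> and \<open>h k = P (h (k + 1))\<close> elsewhere, while
  periodicity makes \<open>h N\<close> a multiple of a translate of \<open>h 0\<close>. The function \<open>pch\<close> is the
  transform of \<open>h 0 - P ^ N (h N) = (\<Sum>k<N. P ^ k (h k - P (h (k + 1))))\<close>. The defect
  \<open>h k - P (h (k + 1))\<close> is a multiple of \<open>(1 - \<rho>) ^ x\<close> above \<open>a k\<close> and vanishes below, hence
  \<open>pch\<close> is a combination of the column functions \<open>w ^ (- j) * (w + 1) ^ (y j + j)\<close> of the
  determinant in \<open>GY\<close>. At a right Bethe root the same combination telescopes over one period:
  it vanishes except at \<open>v\<close>, where it equals minus the logarithmic derivative of
  \<open>w ^ N * (w + 1) ^ (L - N)\<close>. By Cramer's rule these values determine the combination as a ratio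
  of determinants in which the row of \<open>v\<close> is replaced by that of \<open>u\<close>.\<close>

section \<open>Bethe roots\<close>

text \<open>The right side is the modulus of \<open>w ^ N * (w + 1) ^ (L - N)\<close> at its
  critical point \<open>- N / L\<close>, which makes \<open>rNL\<close> the threshold for
  \<open>cmod z\<close>.\<close>

lemma rNL_pow:
  assumes "0 < N" "N < L"
  shows "rNL N L ^ L = (real N / real L) ^ N * (1 - real N / real L) ^ (L - N)"
proof -
  have p: "0 < real N / real L" "0 < 1 - real N / real L" using assms by auto
  have e1: "((real N / real L) powr (real N / real L)) ^ L = (real N / real L) ^ N"
    using p assms by (simp add: powr_powr powr_realpow flip: powr_realpow[of _ L])
  have "(1 - real N / real L) * real L = real (L - N)"
    using assms by (simp add: field_simps of_nat_diff)
  then have e2: "((1 - real N / real L) powr (1 - real N / real L)) ^ L = (1 - real N / real L) ^ (L - N)"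
    using p assms by (simp add: powr_powr powr_realpow[OF p(2), symmetric] powr_realpow flip: powr_realpow[of _ L])
  show ?thesis unfolding rNL_def power_mult_distrib e1 e2 ..
qed

lemma qz_root_norm:
  assumes "qz N L z w = 0"
  shows "cmod w ^ N * cmod (w + 1) ^ (L - N) = cmod z ^ L"
  using assms unfolding qz_def by (metis eq_iff_diff_eq_0 norm_mult norm_power)

lemma qz_root_nonzero:
  assumes "0 < N" "N < L" "z \<noteq> 0" "qz N L z w = 0"
  shows "w \<noteq> 0" "w + 1 \<noteq> 0"
  using assms unfolding qz_def by (auto simp: zero_power)

text \<open>On the vertical line through the critical point both \<open>cmod w\<close> and
  \<open>cmod (w + 1)\<close> are smallest at that point, so their product of powers is at least
  \<open>rNL N L ^ L\<close>, too large for a root.\<close>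

lemma qz_root_Re:
  assumes "0 < N" "N < L" "cmod z < rNL N L" "qz N L z w = 0"
  shows "Re w \<noteq> - (real N / real L)"
proof
  assume R: "Re w = - (real N / real L)"
  have "cmod z ^ L < rNL N L ^ L"
    by (rule power_strict_mono) (use assms in auto)
  also have "\<dots> = (real N / real L) ^ N * (1 - real N / real L) ^ (L - N)"
    using rNL_pow assms by blast
  also have "\<dots> \<le> cmod w ^ N * cmod (w + 1) ^ (L - N)"
  proof (intro mult_mono power_mono)
    show "real N / real L \<le> cmod w"
      using abs_Re_le_cmod[of w] R by simp
    show "1 - real N / real L \<le> cmod (w + 1)"
      using abs_Re_le_cmod[of "w + 1"] R by simp
  qed (use assms in auto)
  finally show False using qz_root_norm[OF assms(4)] by simp
qed

section \<open>Simple roots and factorisation of the Bethe polynomial\<close>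

definition qz_poly :: "nat \<Rightarrow> nat \<Rightarrow> complex \<Rightarrow> complex poly" where
  "qz_poly N L z = monom 1 N * [:1, 1:] ^ (L - N) - [:z ^ L:]"

lemma poly_qz_poly: "poly (qz_poly N L z) w = qz N L z w"
  by (simp add: qz_poly_def qz_def poly_monom add.commute)

lemma lead_coeff_qz_poly:
  assumes "0 < N" "N < L"
  shows "lead_coeff (qz_poly N L z) = 1"
proof -
  let ?p = "monom 1 N * [:1, 1:] ^ (L - N) :: complex poly"
  have "degree ?p = N + (L - N)"
    by (subst degree_mult_eq) (auto simp: degree_monom_eq degree_linear_power)
  then have "degree [:- (z ^ L):] < degree ?p"
    using assms by simp
  then have "lead_coeff ([:- (z ^ L):] + ?p) = lead_coeff ?p"
    by (rule lead_coeff_add_le)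
  also have "\<dots> = 1"
    by (simp add: lead_coeff_mult lead_coeff_power degree_monom_eq)
  finally show ?thesis
    by (simp only: qz_poly_def diff_conv_add_uminus add.commute minus_pCons minus_zero)
qed

lemma pderiv_qz_poly:
  assumes "0 < N" "N < L"
  shows "poly (pderiv (qz_poly N L z)) w
    = (of_nat N + of_nat L * w) * w ^ (N - 1) * (w + 1) ^ (L - N - 1)"
proof -
  obtain n m where nm: "N = Suc n" "L - N = Suc m"
    using assms by (metis Suc_pred zero_less_diff)
  then have L: "L = Suc n + Suc m" using assms by simp
  show ?thesis
    unfolding qz_poly_def nm(2)
    by (simp add: nm(1) L pderiv_diff pderiv_mult pderiv_monom pderiv_power_Suc poly_monom pderiv_pCons
        del: mult_pCons_left mult_pCons_right power_Suc)
      (simp add: algebra_simps)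
qed

lemma left_right_roots:
  assumes "0 < N" "N < L" "cmod z < rNL N L"
  shows "left_roots N L z \<union> right_roots N L z = {w. qz N L z w = 0}"
    and "left_roots N L z \<inter> right_roots N L z = {}"
proof -
  have "Re w < - (real N / real L) \<or> Re w > - (real N / real L)" if "qz N L z w = 0" for w
    using qz_root_Re[OF assms that] by linarith
  then show "left_roots N L z \<union> right_roots N L z = {w. qz N L z w = 0}"
    unfolding left_roots_def right_roots_def by blast
qed (auto simp: left_roots_def right_roots_def)

lemma finite_qz_roots:
  assumes "0 < N" "N < L"
  shows "finite {w. qz N L z w = 0}" "finite (left_roots N L z)" "finite (right_roots N L z)"
proof -
  have "qz_poly N L z \<noteq> 0"
    using lead_coeff_qz_poly[OF assms, of z] by auto
  then show f: "finite {w. qz N L z w = 0}"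
    using poly_roots_finite[of "qz_poly N L z"] by (simp add: poly_qz_poly)
  show "finite (left_roots N L z)" "finite (right_roots N L z)"
    by (rule finite_subset[OF _ f], auto simp: left_roots_def right_roots_def)+
qed

text \<open>The derivative can vanish only at \<open>0\<close>, \<open>-1\<close> and
  \<open>- N / L\<close>. The first two are no roots because \<open>z \<noteq> 0\<close>, the third
  because the critical line carries no root.\<close>

lemma qz_root_simple:
  assumes "0 < N" "N < L" "z \<noteq> 0" "cmod z < rNL N L" "qz N L z w = 0"
  shows "of_nat N + of_nat L * w \<noteq> 0"
    and "poly (pderiv (qz_poly N L z)) w \<noteq> 0"
proof -
  show n: "of_nat N + of_nat L * w \<noteq> 0"
  proof
    assume "of_nat N + of_nat L * w = 0"
    then have "w = - (of_nat N / of_nat L)"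
      using assms by (simp add: field_simps add_eq_0_iff)
    then have "Re w = - (real N / real L)"
      by simp
    then show False using qz_root_Re assms by blast
  qed
  then show "poly (pderiv (qz_poly N L z)) w \<noteq> 0"
    using qz_root_nonzero[OF assms(1,2,3,5)] by (simp add: pderiv_qz_poly[OF assms(1,2)])
qed

text \<open>Both sides are the derivative of \<open>qz N L z\<close> at \<open>v\<close>, on the
  left from the factorisation over the simple roots, on the right from the product rule. This makes
  \<open>qzL\<close> explicit at \<open>v\<close>.\<close>

lemma qzL_qzR_deriv:
  assumes "0 < N" "N < L" "z \<noteq> 0" "cmod z < rNL N L" "v \<in> right_roots N L z"
  shows "qzL N L z v * (\<Prod>v'\<in>right_roots N L z - {v}. v - v')
    = (of_nat N + of_nat L * v) * v ^ (N - 1) * (v + 1) ^ (L - N - 1)"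
proof -
  let ?p = "qz_poly N L z"
  let ?Z = "{w. qz N L z w = 0}"
  let ?r = "\<Prod>w\<in>?Z - {v}. [:- w, 1:]"
  have v: "qz N L z v = 0"
    using assms by (simp add: right_roots_def)
  have "rsquarefree ?p"
    unfolding rsquarefree_roots using qz_root_simple(2)[OF assms(1-4)] by (auto simp: poly_qz_poly)
  then have "(\<Prod>w\<in>?Z. [:- w, 1:]) = ?p"
    using complex_poly_decompose_rsquarefree[of ?p] lead_coeff_qz_poly[OF assms(1,2)]
    by (simp add: poly_qz_poly)
  then have "?p = [:- v, 1:] * ?r"
    using prod.remove[OF finite_qz_roots(1)[OF assms(1,2), of z], of v "\<lambda>w. [:- w, 1:]"] v
    by (simp del: mult_pCons_left mult_pCons_right)
  then have "poly (pderiv ?p) v = poly ?r v"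
    by (simp add: pderiv_mult pderiv_pCons del: mult_pCons_left mult_pCons_right)
  also have "\<dots> = (\<Prod>w\<in>?Z - {v}. v - w)"
    by (simp add: poly_prod)
  also have "?Z - {v} = left_roots N L z \<union> (right_roots N L z - {v})"
    using left_right_roots[OF assms(1,2,4)] assms(5) by blast
  also have "(\<Prod>w\<in>\<dots>. v - w) = qzL N L z v * (\<Prod>v'\<in>right_roots N L z - {v}. v - v')"
    unfolding qzL_def using left_right_roots[OF assms(1,2,4)] finite_qz_roots[OF assms(1,2), of z]
    by (intro prod.union_disjoint) auto
  finally show ?thesis
    by (simp add: pderiv_qz_poly[OF assms(1,2)])
qed

lemma right_roots_bound:
  assumes "0 < N" "N < L" "r1 N L z < \<rho>" "v \<in> right_roots N L z"
  shows "cmod v < \<rho>"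
proof -
  have "cmod v \<le> r1 N L z"
    unfolding r1_def using assms finite_qz_roots[OF assms(1,2), of z] by (intro Max_ge) auto
  then show ?thesis using assms by simp
qed

lemma left_roots_bound:
  assumes "0 < N" "N < L" "\<rho> < 1 - r2 N L z" "v \<in> left_roots N L z"
  shows "cmod (v + 1) < 1 - \<rho>"
proof -
  have "cmod (v + 1) \<le> r2 N L z"
    unfolding r2_def using assms finite_qz_roots[OF assms(1,2), of z] by (intro Max_ge) auto
  then show ?thesis using assms by simp
qed

text \<open>The disc of radius \<open>\<rho>\<close> around \<open>0\<close> contains exactly the right roots, and on its boundary
  \<open>w ^ N * (w + 1) ^ (L - N)\<close> dominates \<open>z ^ L\<close>, so Rouche's theorem counts them.\<close>

lemma card_right_roots:
  assumes "0 < N" "N < L" "z \<noteq> 0" "cmod z < rNL N L" "0 < \<rho>" "\<rho> < 1"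
    and r: "r1 N L z < \<rho>" "\<rho> < 1 - r2 N L z"
    and big: "\<rho> ^ N * (1 - \<rho>) ^ (L - N) > cmod z ^ L"
  shows "card (right_roots N L z) = N"
proof -
  define f g :: "complex \<Rightarrow> complex" where "f = (\<lambda>w. w ^ N * (w + 1) ^ (L - N))" and "g = (\<lambda>_. - (z ^ L))"
  let ?\<gamma> = "circlepath 0 \<rho>"
  have fg: "f w + g w = qz N L z w" for w
    by (simp add: f_def g_def qz_def)
  have f0: "{w. f w = 0} = {0, -1}"
    using assms by (auto simp: f_def eq_neg_iff_add_eq_0 add.commute)
  have W1: "winding_number ?\<gamma> w = 1" if "cmod w < \<rho>" for w
    using winding_number_circlepath[of w 0 \<rho>] that by simp
  have W0: "winding_number ?\<gamma> w = 0" if "cmod w > \<rho>" for w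
  proof (rule winding_number_zero_outside[where s = "cball 0 \<rho>"])
    show "path_image ?\<gamma> \<subseteq> cball 0 \<rho>"
      using assms by (auto simp: path_image_circlepath)
  qed (use that in auto)
  \<comment> \<open>Since \<open>w\<close> and \<open>w + 1\<close> differ by 1, a small
    \<open>cmod (w + 1)\<close> pushes \<open>w\<close> out of the disc.\<close>
  have out: "cmod w > \<rho>" if "w \<in> left_roots N L z" for w
  proof -
    have "1 \<le> cmod w + cmod (w + 1)"
      using norm_triangle_ineq4[of "w + 1" w] by simp
    then show ?thesis using left_roots_bound[OF assms(1,2) r(2) that] by simp
  qed
  have "(\<Sum>p | p \<in> UNIV \<and> f p + g p = 0. winding_number ?\<gamma> p * of_int (zorder (\<lambda>p. f p + g p) p))
      = (\<Sum>p | p \<in> UNIV \<and> f p = 0. winding_number ?\<gamma> p * of_int (zorder f p))"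
  proof (rule Rouche_theorem)
    show "finite {p \<in> UNIV. f p + g p = 0}"
      using finite_qz_roots(1)[OF assms(1,2)] by (simp add: fg)
    show "finite {p \<in> UNIV. f p = 0}"
      using f0 by simp
    show "\<forall>p\<in>path_image ?\<gamma>. cmod (g p) < cmod (f p)"
    proof
      fix p assume "p \<in> path_image ?\<gamma>"
      then have p: "cmod p = \<rho>"
        using assms by (auto simp: path_image_circlepath)
      have "1 - \<rho> \<le> cmod (p + 1)"
        using norm_triangle_ineq4[of "p + 1" p] p by simp
      then have "\<rho> ^ N * (1 - \<rho>) ^ (L - N) \<le> cmod (f p)"
        unfolding f_def norm_mult norm_power p
        using assms by (intro mult_left_mono power_mono) auto
      then show "cmod (g p) < cmod (f p)"
        using big by (simp add: g_def norm_power)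
    qed
  qed (auto simp: f_def g_def intro!: holomorphic_intros)
  also have "{p. p \<in> UNIV \<and> f p + g p = 0} = left_roots N L z \<union> right_roots N L z"
    by (simp add: fg left_right_roots[OF assms(1,2,4)])
  also have "(\<Sum>p\<in>\<dots>. winding_number ?\<gamma> p * of_int (zorder (\<lambda>p. f p + g p) p))
      = (\<Sum>p\<in>right_roots N L z. winding_number ?\<gamma> p * of_int (zorder (\<lambda>p. f p + g p) p))"
    using finite_qz_roots[OF assms(1,2), of z] out left_right_roots(2)[OF assms(1,2,4)] W0
    by (intro sum.mono_neutral_right) auto
  \<comment> \<open>Simplicity of the roots turns the count with multiplicity into a
    cardinality.\<close>
  also have "\<dots> = (\<Sum>p\<in>right_roots N L z. 1)"
  proof (rule sum.cong)
    fix p assume p: "p \<in> right_roots N L z"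
    then have q0: "qz N L z p = 0"
      by (simp add: right_roots_def)
    have "((\<lambda>w. poly (qz_poly N L z) w) has_field_derivative poly (pderiv (qz_poly N L z)) p) (at p)"
      by (rule poly_DERIV)
    then have "deriv (\<lambda>w. poly (qz_poly N L z) w) p \<noteq> 0"
      using qz_root_simple(2)[OF assms(1-4) q0] by (metis DERIV_imp_deriv)
    then have "deriv (qz N L z) p \<noteq> 0"
      by (simp add: poly_qz_poly[abs_def])
    moreover have "qz N L z holomorphic_on UNIV"
      unfolding qz_def[abs_def] by (intro holomorphic_intros)
    ultimately have "zorder (qz N L z) p = 1"
      using zorder_zero_eqI[of "qz N L z" UNIV p 1] q0 by auto
    then show "winding_number ?\<gamma> p * of_int (zorder (\<lambda>p. f p + g p) p) = 1"
      using W1 right_roots_bound[OF assms(1,2) r(1) p] by (simp add: fg[abs_def])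
  qed simp
  \<comment> \<open>Of the two zeros of \<open>f\<close> only \<open>0\<close> lies in the disc, as
    \<open>\<rho> < 1\<close>.\<close>
  also have "(\<Sum>p | p \<in> UNIV \<and> f p = 0. winding_number ?\<gamma> p * of_int (zorder f p)) = of_int (zorder f 0)"
    using f0 W0[of "-1"] W1[of 0] assms by simp
  also have "zorder f 0 = int N"
  proof (rule zorder_eqI[where S = UNIV and g = "\<lambda>w. (w + 1) ^ (L - N)"])
    show "(\<lambda>w. (w + 1) ^ (L - N)) holomorphic_on UNIV"
      by (intro holomorphic_intros)
  qed (auto simp: f_def)
  finally show ?thesis
    by simp
qed

section \<open>Averages over a geometric step\<close>

text \<open>The transition operator \<open>P\<close> of the walk: a step equals
  \<open>- 1 - n\<close> with probability \<open>\<rho> * (1 - \<rho>) ^ n\<close>. The series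
  converges absolutely for bounded \<open>g\<close>.\<close>

definition geo_avg :: "real \<Rightarrow> (int \<Rightarrow> complex) \<Rightarrow> int \<Rightarrow> complex" where
  "geo_avg \<rho> g x = (\<Sum>n. of_real (\<rho> * (1 - \<rho>) ^ n) * g (x - 1 - int n))"

lemma geo_weights_sums:
  assumes "0 < \<rho>" "\<rho> < (1::real)"
  shows "(\<lambda>n. \<rho> * (1 - \<rho>) ^ n) sums 1"
  using sums_mult[OF geometric_sums[of "1 - \<rho>"], of \<rho>] assms by simp

lemma geo_avg_norm_summable:
  assumes "0 < \<rho>" "\<rho> < 1" "\<And>x. cmod (g x) \<le> C"
  shows "summable (\<lambda>n. cmod (of_real (\<rho> * (1 - \<rho>) ^ n) * g (x - 1 - int n)))"
proof (rule summable_comparison_test')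
  show "summable (\<lambda>n. \<rho> * (1 - \<rho>) ^ n * C)"
    using geo_weights_sums[OF assms(1,2)] by (intro summable_mult2) (simp add: sums_iff)
  show "norm (cmod (of_real (\<rho> * (1 - \<rho>) ^ n) * g (x - 1 - int n))) \<le> \<rho> * (1 - \<rho>) ^ n * C" if "n \<ge> 0" for n
    using assms by (simp add: norm_mult norm_power abs_mult mult_left_mono del: of_real_mult of_real_power)
qed

lemmas geo_avg_summable = geo_avg_norm_summable[THEN summable_norm_cancel]

lemma geo_avg_bounded:
  assumes "0 < \<rho>" "\<rho> < 1" "\<And>x. cmod (g x) \<le> C"
  shows "cmod (geo_avg \<rho> g x) \<le> C"
proof -
  have "cmod (geo_avg \<rho> g x) \<le> (\<Sum>n. cmod (of_real (\<rho> * (1 - \<rho>) ^ n) * g (x - 1 - int n)))"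
    unfolding geo_avg_def by (rule summable_norm[OF geo_avg_norm_summable[OF assms]])
  also have "\<dots> \<le> (\<Sum>n. \<rho> * (1 - \<rho>) ^ n * C)"
  proof (rule suminf_le[OF _ geo_avg_norm_summable[OF assms]])
    show "summable (\<lambda>n. \<rho> * (1 - \<rho>) ^ n * C)"
      using geo_weights_sums[OF assms(1,2)] by (intro summable_mult2) (simp add: sums_iff)
    show "cmod (of_real (\<rho> * (1 - \<rho>) ^ n) * g (x - 1 - int n)) \<le> \<rho> * (1 - \<rho>) ^ n * C" for n
      using assms by (simp add: norm_mult norm_power abs_mult mult_left_mono del: of_real_mult of_real_power)
  qed
  also have "\<dots> = C"
    using sums_mult2[OF geo_weights_sums[OF assms(1,2)], of C] by (simp add: sums_iff)
  finally show ?thesis .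
qed

text \<open>Memorylessness: from \<open>x + 1\<close> the walk moves to \<open>x\<close> with
  probability \<open>\<rho>\<close> and otherwise behaves like a step from \<open>x\<close>. The
  transform identities and the defect formula rest on this recursion.\<close>

lemma geo_avg_step:
  assumes "0 < \<rho>" "\<rho> < 1" "\<And>x. cmod (g x) \<le> C"
  shows "geo_avg \<rho> g (x + 1) = of_real \<rho> * g x + of_real (1 - \<rho>) * geo_avg \<rho> g x"
proof -
  have "geo_avg \<rho> g (x + 1) = of_real (\<rho> * (1 - \<rho>) ^ 0) * g (x + 1 - 1 - int 0)
      + (\<Sum>n. of_real (\<rho> * (1 - \<rho>) ^ Suc n) * g (x + 1 - 1 - int (Suc n)))"
    unfolding geo_avg_def using suminf_split_head[OF geo_avg_summable[of \<rho> g C "x + 1", OF assms]]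
    by simp
  also have "(\<Sum>n. of_real (\<rho> * (1 - \<rho>) ^ Suc n) * g (x + 1 - 1 - int (Suc n)))
      = (\<Sum>n. of_real (1 - \<rho>) * (of_real (\<rho> * (1 - \<rho>) ^ n) * g (x - 1 - int n)))"
    by (simp add: algebra_simps)
  also have "\<dots> = of_real (1 - \<rho>) * geo_avg \<rho> g x"
    unfolding geo_avg_def by (rule suminf_mult[OF geo_avg_summable[OF assms]])
  finally show ?thesis by simp
qed

lemma geo_avg_diff:
  assumes "0 < \<rho>" "\<rho> < 1" "\<And>x. cmod (f x) \<le> B" "\<And>x. cmod (g x) \<le> C"
  shows "geo_avg \<rho> (\<lambda>x. f x - g x) x = geo_avg \<rho> f x - geo_avg \<rho> g x"
  unfolding geo_avg_def
  using suminf_diff[OF geo_avg_summable[of \<rho> f B x, OF assms(1-3)] geo_avg_summable[of \<rho> g C x, OF assms(1,2,4)]]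
  by (simp add: algebra_simps)

lemma geo_avg_cmult:
  assumes "0 < \<rho>" "\<rho> < 1" "\<And>x. cmod (g x) \<le> C"
  shows "geo_avg \<rho> (\<lambda>x. c * g x) x = c * geo_avg \<rho> g x"
  unfolding geo_avg_def
  using suminf_mult[OF geo_avg_summable[of \<rho> g C x, OF assms], of c]
  by (simp add: algebra_simps)

lemma geo_avg_zero:
  assumes "\<And>x. x \<le> a \<Longrightarrow> g x = 0" "x \<le> a"
  shows "geo_avg \<rho> g x = 0"
proof -
  have "g (x - 1 - int n) = 0" for n
    using assms by simp
  then show ?thesis
    by (simp add: geo_avg_def)
qed

lemma geo_avg_pow_bounded:
  assumes "0 < \<rho>" "\<rho> < 1" "\<And>x. cmod (g x) \<le> C"
  shows "cmod ((geo_avg \<rho> ^^ k) g x) \<le> C"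
  by (induction k arbitrary: x) (auto intro: assms geo_avg_bounded)

lemma geo_avg_pow_zero:
  assumes "\<And>x. x \<le> a \<Longrightarrow> g x = 0"
  shows "x \<le> a \<Longrightarrow> (geo_avg \<rho> ^^ k) g x = 0"
proof (induction k arbitrary: x)
  case (Suc k)
  then show ?case
    using geo_avg_zero[of a "(geo_avg \<rho> ^^ k) g" x \<rho>] by simp
qed (simp add: assms)

lemma geo_avg_pow_diff:
  assumes "0 < \<rho>" "\<rho> < 1" "\<And>x. cmod (f x) \<le> B" "\<And>x. cmod (g x) \<le> C"
  shows "(geo_avg \<rho> ^^ k) (\<lambda>x. f x - g x) = (\<lambda>x. (geo_avg \<rho> ^^ k) f x - (geo_avg \<rho> ^^ k) g x)"
proof (induction k)
  case (Suc k)
  show ?case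
    by (auto simp: Suc intro!: geo_avg_diff[OF assms(1,2)]
        geo_avg_pow_bounded[OF assms(1,2,3)] geo_avg_pow_bounded[OF assms(1,2,4)])
qed simp

text \<open>By linearity on bounded functions the summand is
  \<open>P ^ k (h k) - P ^ (k + 1) (h (k + 1))\<close>.\<close>

lemma geo_avg_pow_telescope:
  assumes "0 < \<rho>" "\<rho> < 1" "\<And>k. \<exists>C. \<forall>x. cmod (h k x) \<le> C"
  shows "h 0 x - (geo_avg \<rho> ^^ n) (h n) x
    = (\<Sum>k<n. (geo_avg \<rho> ^^ k) (\<lambda>x. h k x - geo_avg \<rho> (h (Suc k)) x) x)"
proof (induction n)
  case (Suc n)
  obtain C C' where C: "\<And>x. cmod (h n x) \<le> C" "\<And>x. cmod (h (Suc n) x) \<le> C'"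
    using assms(3) by metis
  have "(geo_avg \<rho> ^^ n) (\<lambda>x. h n x - geo_avg \<rho> (h (Suc n)) x) x
      = (geo_avg \<rho> ^^ n) (h n) x - (geo_avg \<rho> ^^ Suc n) (h (Suc n)) x"
    using geo_avg_pow_diff[OF assms(1,2) C(1) geo_avg_bounded[OF assms(1,2) C(2)], of n]
    by (simp add: funpow_swap1)
  then show ?case
    using Suc by (simp add: algebra_simps)
qed simp

section \<open>Transforms of averages over the integers and over half-lines\<close>

lemma has_sum_powi_above:
  fixes t :: complex
  assumes "t \<noteq> 0" "cmod t < 1"
  shows "((\<lambda>x. t powi x) has_sum (t powi (a + 1) / (1 - t))) {a<..}"
    and "(\<lambda>x. cmod (t powi x)) summable_on {a<..}"
proof -
  have bij: "bij_betw (\<lambda>n. a + 1 + int n) UNIV {a<..}"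
    by (rule bij_betwI[where g = "\<lambda>x. nat (x - a - 1)"]) auto
  have e: "t powi (a + 1 + int n) = t powi (a + 1) * t ^ n" for n
    using assms by (subst power_int_add) auto
  have s: "summable (\<lambda>n. cmod (t powi (a + 1) * t ^ n))"
    using assms by (simp add: norm_mult norm_power summable_mult summable_geometric)
  have "(\<lambda>n. t powi (a + 1) * t ^ n) sums (t powi (a + 1) / (1 - t))"
    using sums_mult[OF geometric_sums[of t], of "t powi (a + 1)"] assms by simp
  then have "((\<lambda>n. t powi (a + 1 + int n)) has_sum (t powi (a + 1) / (1 - t))) UNIV"
    unfolding e using norm_summable_imp_has_sum[OF s] by blast
  then show "((\<lambda>x. t powi x) has_sum (t powi (a + 1) / (1 - t))) {a<..}"
    using has_sum_reindex_bij_betw[OF bij, of "\<lambda>x. t powi x"] by simp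
  have "(\<lambda>n. cmod (t powi (a + 1 + int n))) summable_on UNIV"
    unfolding e using norm_summable_imp_summable_on[of "\<lambda>n. cmod (t powi (a + 1) * t ^ n)"] s by simp
  then show "(\<lambda>x. cmod (t powi x)) summable_on {a<..}"
    using summable_on_reindex_bij_betw[OF bij, of "\<lambda>x. cmod (t powi x)"] by simp
qed

text \<open>The regime of \<open>pch\<close>: the powers decay to the right, and \<open>g\<close> is
  cut off on the left.\<close>

lemma summable_above:
  fixes t :: complex
  assumes "t \<noteq> 0" "cmod t < 1" "\<And>x. cmod (g x) \<le> C" "\<And>x. x \<le> a \<Longrightarrow> g x = 0"
  shows "(\<lambda>x. t powi x * g x) summable_on UNIV"
proof -
  have "(\<lambda>x. cmod (t powi x * g x)) summable_on {a<..}"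
  proof (rule Infinite_Sum.abs_summable_on_comparison_test')
    show "(\<lambda>x. cmod (t powi x) * C) summable_on {a<..}"
      using has_sum_powi_above(2)[OF assms(1,2)] by (rule summable_on_cmult_left)
    show "cmod (t powi x * g x) \<le> cmod (t powi x) * C" for x
      by (simp add: norm_mult mult_left_mono assms(3))
  qed
  then have "(\<lambda>x. t powi x * g x) summable_on {a<..}"
    by (rule abs_summable_summable)
  then show ?thesis
    by (subst summable_on_cong_neutral[where T = "{a<..}" and g = "\<lambda>x. t powi x * g x"])
      (auto simp: assms(4))
qed

text \<open>The regime of the right roots, where \<open>t\<close> has modulus above 1 and the powers
  decay to the left. Reflection reduces it to the previous geometric series.\<close>

lemma summable_below:
  fixes t :: complex
  assumes "1 < cmod t" "\<And>x. cmod (g x) \<le> C"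
  shows "(\<lambda>x. t powi x * g x) summable_on {..a}"
proof -
  have t: "t \<noteq> 0" using assms(1) by auto
  have "(\<lambda>x. inverse t powi x * g (- x)) summable_on {- a - 1<..}"
  proof (rule abs_summable_summable, rule Infinite_Sum.abs_summable_on_comparison_test')
    show "(\<lambda>x. cmod (inverse t powi x) * C) summable_on {- a - 1<..}"
      by (rule summable_on_cmult_left, rule has_sum_powi_above(2))
        (use assms(1) t in \<open>auto simp: norm_inverse inverse_less_1_iff\<close>)
    show "cmod (inverse t powi x * g (- x)) \<le> cmod (inverse t powi x) * C" for x
      by (simp add: norm_mult mult_left_mono assms(2))
  qed
  also have "?this \<longleftrightarrow> ?thesis"
    by (rule summable_on_reindex_bij_witness[where i = uminus and j = uminus])
      (auto simp: power_int_minus power_int_inverse)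
  finally show ?thesis .
qed

text \<open>Dividing by \<open>s\<close> shifts the summation index, and \<open>geo_avg_step\<close>
  then gives a linear equation for the transform. So \<open>P\<close> acts as multiplication by
  \<open>\<rho> / (1 / s - (1 - \<rho>))\<close> where this is defined.\<close>

lemma geo_avg_transform:
  fixes s :: complex
  assumes \<rho>: "0 < \<rho>" "\<rho> < 1" and s: "s \<noteq> 0" "cmod s < 1"
    and C: "\<And>x. cmod (g x) \<le> C" and a: "\<And>x. x \<le> a \<Longrightarrow> g x = 0"
  shows "(1 / s - of_real (1 - \<rho>)) * (\<Sum>\<^sub>\<infinity>x. s powi x * geo_avg \<rho> g x)
    = of_real \<rho> * (\<Sum>\<^sub>\<infinity>x. s powi x * g x)"
proof -
  let ?P = "geo_avg \<rho> g"
  have sg: "(\<lambda>x. s powi x * g x) summable_on UNIV"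
    by (rule summable_above[OF s C a])
  have sP: "(\<lambda>x. s powi x * ?P x) summable_on UNIV"
    by (rule summable_above[OF s geo_avg_bounded[OF \<rho> C] geo_avg_zero[OF a]])
  have "1 / s * (\<Sum>\<^sub>\<infinity>x. s powi x * ?P x) = (\<Sum>\<^sub>\<infinity>x. 1 / s * (s powi x * ?P x))"
    by (simp only: infsum_cmult_right'[symmetric])
  also have "\<dots> = (\<Sum>\<^sub>\<infinity>x. s powi x * ?P (x + 1))"
    by (rule infsum_reindex_bij_witness[where i = "\<lambda>x. x + 1" and j = "\<lambda>x. x - 1"])
      (use s in \<open>auto simp: power_int_diff\<close>)
  also have "\<dots> = (\<Sum>\<^sub>\<infinity>x. of_real \<rho> * (s powi x * g x) + of_real (1 - \<rho>) * (s powi x * ?P x))"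
    unfolding geo_avg_step[OF \<rho> C] by (simp add: algebra_simps)
  also have "\<dots> = of_real \<rho> * (\<Sum>\<^sub>\<infinity>x. s powi x * g x) + of_real (1 - \<rho>) * (\<Sum>\<^sub>\<infinity>x. s powi x * ?P x)"
    by (subst infsum_add) (auto intro!: summable_on_cmult_right sg sP simp: infsum_cmult_right')
  finally show ?thesis
    by (simp add: algebra_simps)
qed

lemma geo_avg_pow_transform:
  fixes s :: complex
  assumes \<rho>: "0 < \<rho>" "\<rho> < 1" and s: "s \<noteq> 0" "cmod s < 1"
    and C: "\<And>x. cmod (g x) \<le> C" and a: "\<And>x. x \<le> a \<Longrightarrow> g x = 0"
    and \<sigma>: "1 / s - of_real (1 - \<rho>) = \<sigma>" "\<sigma> \<noteq> 0"
  shows "(\<Sum>\<^sub>\<infinity>x. s powi x * (geo_avg \<rho> ^^ k) g x) = (of_real \<rho> / \<sigma>) ^ k * (\<Sum>\<^sub>\<infinity>x. s powi x * g x)"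
proof (induction k)
  case (Suc k)
  have "\<sigma> * (\<Sum>\<^sub>\<infinity>x. s powi x * (geo_avg \<rho> ^^ Suc k) g x) = of_real \<rho> * (\<Sum>\<^sub>\<infinity>x. s powi x * (geo_avg \<rho> ^^ k) g x)"
    using geo_avg_transform[OF \<rho> s geo_avg_pow_bounded[OF \<rho> C, where k = k] geo_avg_pow_zero[OF a, where k = k]] \<sigma>(1)
    by simp
  then show ?case
    using \<sigma>(2) by (simp add: Suc field_simps)
qed simp

text \<open>The same shift on a half-line moves its endpoint, which leaves the boundary term at
  \<open>a + 1\<close>.\<close>

lemma geo_avg_transform_below:
  fixes s :: complex
  assumes \<rho>: "0 < \<rho>" "\<rho> < 1" and s: "1 < cmod s" and C: "\<And>x. cmod (g x) \<le> C"
  shows "(1 / s - of_real (1 - \<rho>)) * (\<Sum>\<^sub>\<infinity>x\<in>{..a}. s powi x * geo_avg \<rho> g x)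
      + s powi a * geo_avg \<rho> g (a + 1)
    = of_real \<rho> * (\<Sum>\<^sub>\<infinity>x\<in>{..a}. s powi x * g x)"
proof -
  let ?P = "geo_avg \<rho> g"
  have s0: "s \<noteq> 0" using s by auto
  have sg: "(\<lambda>x. s powi x * g x) summable_on {..a}"
    by (rule summable_below[OF s C])
  have sP: "(\<lambda>x. s powi x * ?P x) summable_on {..b}" for b
    by (rule summable_below[OF s geo_avg_bounded[OF \<rho> C]])
  have "{..a + 1} = insert (a + 1) {..a}"
    by auto
  then have "1 / s * (s powi (a + 1) * ?P (a + 1) + (\<Sum>\<^sub>\<infinity>x\<in>{..a}. s powi x * ?P x))
      = 1 / s * (\<Sum>\<^sub>\<infinity>x\<in>{..a + 1}. s powi x * ?P x)"
    by (simp only:) (subst infsum_insert[OF sP], auto)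
  also have "\<dots> = (\<Sum>\<^sub>\<infinity>x\<in>{..a + 1}. 1 / s * (s powi x * ?P x))"
    by (simp only: infsum_cmult_right'[symmetric])
  also have "\<dots> = (\<Sum>\<^sub>\<infinity>x\<in>{..a}. s powi x * ?P (x + 1))"
    by (rule infsum_reindex_bij_witness[where i = "\<lambda>x. x + 1" and j = "\<lambda>x. x - 1"])
      (use s0 in \<open>auto simp: power_int_diff\<close>)
  also have "\<dots> = (\<Sum>\<^sub>\<infinity>x\<in>{..a}. of_real \<rho> * (s powi x * g x) + of_real (1 - \<rho>) * (s powi x * ?P x))"
    unfolding geo_avg_step[OF \<rho> C] by (simp add: algebra_simps)
  also have "\<dots> = of_real \<rho> * (\<Sum>\<^sub>\<infinity>x\<in>{..a}. s powi x * g x)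
      + of_real (1 - \<rho>) * (\<Sum>\<^sub>\<infinity>x\<in>{..a}. s powi x * ?P x)"
    by (subst infsum_add) (auto intro!: summable_on_cmult_right sg sP simp: infsum_cmult_right')
  finally show ?thesis
    using s0 by (simp add: algebra_simps power_int_add)
qed

section \<open>Telescoping of the transformed hitting values\<close>

definition wt :: "real \<Rightarrow> complex \<Rightarrow> nat \<Rightarrow> int \<Rightarrow> complex" where
  "wt \<rho> v k x = of_real (1 - \<rho>) powi x / (v + 1) powi (x + 1)
    * (- v * of_real (1 - \<rho>) / ((v + 1) * of_real \<rho>)) ^ k"

lemma ch_weight_eq_wt: "ch_weight \<rho> v G t = wt \<rho> v t (G t)"
  by (simp add: ch_weight_def wt_def)

text \<open>A unit of space multiplies the weight by \<open>q\<close>, a unit of time by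
  \<open>r\<close>, and \<open>q = (1 - \<rho>) + \<rho> * r\<close>. This is the recursion of
  \<open>geo_avg_step\<close> with the weight of the next time as \<open>g\<close>.\<close>

lemma wt_step:
  assumes "0 < \<rho>" "\<rho> < 1" "v + 1 \<noteq> 0"
  shows "wt \<rho> v k (x + 1) = of_real (1 - \<rho>) * wt \<rho> v k x + of_real \<rho> * wt \<rho> v (Suc k) x"
proof -
  have nz: "(1 - of_real \<rho> :: complex) \<noteq> 0" "(of_real \<rho> :: complex) \<noteq> 0"
    using assms by (simp_all add: complex_eq_iff)
  define A where "A = of_real (1 - \<rho>) powi x / (v + 1) powi (x + 1)
    * (- v * of_real (1 - \<rho>) / ((v + 1) * of_real \<rho>)) ^ k"
  define q where "q = of_real (1 - \<rho>) / (v + 1)"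
  define r where "r = - v * of_real (1 - \<rho>) / ((v + 1) * of_real \<rho>)"
  have 1: "wt \<rho> v k x = A"
    by (simp add: A_def wt_def)
  have 2: "wt \<rho> v k (x + 1) = A * q"
    using assms nz by (simp add: A_def q_def wt_def power_int_add power2_eq_square mult_ac)
  have 3: "wt \<rho> v (Suc k) x = A * r"
    by (simp add: A_def r_def wt_def)
  have "of_real \<rho> * r = - v * of_real (1 - \<rho>) / (v + 1)"
    using nz by (simp add: r_def)
  then have "q = of_real (1 - \<rho>) + of_real \<rho> * r"
    using assms(3) by (simp only: q_def) (simp add: divide_simps, simp add: algebra_simps)
  then show ?thesis
    unfolding 1 2 3 by (simp only:) (simp add: algebra_simps)
qed

lemma wt_Suc: "wt \<rho> v (Suc k) x = (- v * of_real (1 - \<rho>) / ((v + 1) * of_real \<rho>)) * wt \<rho> v k x"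
  by (simp add: wt_def mult_ac)

lemma sum_geometric_int:
  fixes U :: "int \<Rightarrow> complex"
  assumes "\<And>x. U (x + 1) = r * U x" "r \<noteq> 1" "b \<le> a"
  shows "(\<Sum>x\<in>{b<..a}. U x) = (U (b + 1) - U (a + 1)) / (1 - r)"
  using assms(3)
proof (induction a rule: int_ge_induct)
  case (step a)
  have "{b<..a + 1} = insert (a + 1) {b<..a}"
    using step(1) by auto
  then have "(\<Sum>x\<in>{b<..a + 1}. U x) = U (a + 1) + (U (b + 1) - U (a + 1)) / (1 - r)"
    using step by simp
  also have "\<dots> = (U (b + 1) - U (a + 1 + 1)) / (1 - r)"
    unfolding assms(1)[of "a + 1"] using assms(2) by (simp add: divide_simps) (simp add: algebra_simps)
  finally show ?case .
qed simp

text \<open>The algebra below uses only the recursive description of the mean hitting values, so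
  they are separated here from the walk. Boundedness guarantees convergence of the series.\<close>

locale hitting_values =
  fixes \<rho> :: real and v :: complex and a :: "nat \<Rightarrow> int" and h :: "nat \<Rightarrow> int \<Rightarrow> complex"
  assumes \<rho>: "0 < \<rho>" "\<rho> < 1"
    and v: "v \<noteq> 0" "v + 1 \<noteq> 0"
    and a: "a (Suc k) < a k"
    and h_bounded: "\<exists>C. \<forall>x. cmod (h k x) \<le> C"
    and h_above: "a k < x \<Longrightarrow> h k x = wt \<rho> v k x"
    and h_below: "x \<le> a k \<Longrightarrow> h k x = geo_avg \<rho> (h (Suc k)) x"
begin

text \<open>The coefficient of \<open>(1 - \<rho>) powi x\<close> in the defect, read off at the
  lowest position above the barrier.\<close>

definition gap :: "nat \<Rightarrow> complex" where
  "gap k = (wt \<rho> v k (a k + 1) - geo_avg \<rho> (h (Suc k)) (a k + 1)) / of_real (1 - \<rho>) powi (a k + 1)"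

text \<open>This is \<open>1 / s - (1 - \<rho>)\<close> for \<open>s = t / (1 - \<rho>)\<close>, so
  \<open>\<rho> / ratio t\<close> is the multiplier by which \<open>P\<close> acts on
  transforms.\<close>

definition ratio :: "complex \<Rightarrow> complex" where
  "ratio t = of_real (1 - \<rho>) * (1 - t) / t"

definition contrib :: "complex \<Rightarrow> nat \<Rightarrow> complex" where
  "contrib t k = gap k * (of_real \<rho> / ratio t) ^ k * (t powi (a k + 1) / (1 - t))"

lemma \<rho>_complex: "(of_real \<rho> :: complex) \<noteq> 0" "(1 - of_real \<rho> :: complex) \<noteq> 0"
  using \<rho> by (simp_all add: complex_eq_iff)

text \<open>Above \<open>a k\<close> both \<open>wt \<rho> v k\<close> and \<open>geo_avg \<rho> (h (Suc k))\<close> satisfy the recursion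
  \<open>f (x + 1) = (1 - \<rho>) * f x + \<rho> * wt \<rho> v (Suc k) x\<close>.\<close>

lemma defect:
  "h k x - geo_avg \<rho> (h (Suc k)) x = (if a k < x then gap k * of_real (1 - \<rho>) powi x else 0)"
proof (cases "a k < x")
  case True
  obtain C where C: "\<And>x. cmod (h (Suc k) x) \<le> C"
    using h_bounded by blast
  have "wt \<rho> v k (a k + 1 + int n) - geo_avg \<rho> (h (Suc k)) (a k + 1 + int n)
      = gap k * of_real (1 - \<rho>) powi (a k + 1 + int n)" for n
  proof (induction n)
    case 0
    then show ?case using \<rho>_complex by (simp add: gap_def)
  next
    case (Suc n)
    let ?x = "a k + 1 + int n"
    have w: "h (Suc k) ?x = wt \<rho> v (Suc k) ?x"
      using a[of k] by (intro h_above) simp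
    have "a k + 1 + int (Suc n) = ?x + 1"
      by simp
    then have "wt \<rho> v k (a k + 1 + int (Suc n)) - geo_avg \<rho> (h (Suc k)) (a k + 1 + int (Suc n))
        = wt \<rho> v k (?x + 1) - geo_avg \<rho> (h (Suc k)) (?x + 1)"
      by (simp only:)
    also have "\<dots> = of_real (1 - \<rho>) * (wt \<rho> v k ?x - geo_avg \<rho> (h (Suc k)) ?x)"
      unfolding wt_step[OF \<rho> v(2), of k ?x] geo_avg_step[of \<rho> "h (Suc k)" C ?x, OF \<rho> C] w
      by (simp add: algebra_simps)
    also have "\<dots> = gap k * of_real (1 - \<rho>) powi (?x + 1)"
      unfolding Suc using \<rho>_complex by (simp add: power_int_add power2_eq_square)
    finally show ?case by (simp add: algebra_simps)
  qed
  from this[of "nat (x - a k - 1)"] True show ?thesis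
    by (simp add: h_above)
qed (simp add: h_below)

text \<open>For these \<open>u\<close> all transforms converge, so the telescoped sum can be
  transformed term by term: each \<open>P\<close> yields its multiplier, each defect a geometric
  series.\<close>

lemma transform_defects:
  assumes u: "u + 1 \<noteq> 0" "cmod (u + 1) < 1 - \<rho>"
  shows "(\<Sum>\<^sub>\<infinity>x. ((u + 1) / of_real (1 - \<rho>)) powi x * (h 0 x - (geo_avg \<rho> ^^ n) (h n) x))
    = (\<Sum>k<n. contrib (u + 1) k)"
proof -
  let ?t = "u + 1"
  define s where "s = ?t / of_real (1 - \<rho>)"
  define g where "g k = (\<lambda>x. h k x - geo_avg \<rho> (h (Suc k)) x)" for k
  have s: "s \<noteq> 0" "cmod s < 1"
    using u \<rho> \<rho>_complex by (simp_all add: s_def norm_divide del: of_real_diff)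
  have u0: "u \<noteq> 0"
    using u \<rho> by auto
  have t1: "cmod ?t < 1"
    using u \<rho> by simp
  have \<sigma>: "1 / s - of_real (1 - \<rho>) = ratio ?t" "ratio ?t \<noteq> 0"
    using u u0 \<rho>_complex by (simp_all add: s_def ratio_def field_simps)
  have g0: "g k x = 0" if "x \<le> a k" for k x
    using that by (simp add: g_def defect)
  have gb: "\<exists>C. \<forall>x. cmod (g k x) \<le> C" for k
  proof -
    obtain C C' where C: "\<And>x. cmod (h k x) \<le> C" "\<And>x. cmod (h (Suc k) x) \<le> C'"
      using h_bounded by metis
    have "cmod (g k x) \<le> C + C'" for x
      unfolding g_def by (rule order_trans[OF norm_triangle_ineq4 add_mono[OF C(1) geo_avg_bounded[OF \<rho> C(2)]]])
    then show ?thesis by blast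
  qed
  have sum_g: "(\<Sum>\<^sub>\<infinity>x. s powi x * (geo_avg \<rho> ^^ k) (g k) x) = contrib ?t k" for k
  proof -
    obtain C where C: "\<And>x. cmod (g k x) \<le> C"
      using gb by blast
    \<comment> \<open>The factor \<open>(1 - \<rho>) powi x\<close> of the defect turns powers of
      \<open>s\<close> into powers of \<open>u + 1\<close>.\<close>
    have "(\<Sum>\<^sub>\<infinity>x. s powi x * g k x) = (\<Sum>\<^sub>\<infinity>x\<in>{a k<..}. gap k * ?t powi x)"
    proof (rule infsum_cong_neutral)
      fix x assume "x \<in> UNIV \<inter> {a k<..}"
      then show "s powi x * g k x = gap k * ?t powi x"
        using \<rho>_complex by (simp add: g_def defect s_def power_int_divide_distrib)
    qed (auto simp: g0)
    also have "\<dots> = gap k * (?t powi (a k + 1) / (1 - ?t))"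
      unfolding infsum_cmult_right' using infsumI[OF has_sum_powi_above(1)[OF u(1) t1]] by simp
    finally show ?thesis
      using geo_avg_pow_transform[of \<rho> s "g k" C "a k" "ratio ?t" k, OF \<rho> s C g0 \<sigma>] by (simp add: contrib_def)
  qed
  have summ: "(\<lambda>x. s powi x * (geo_avg \<rho> ^^ k) (g k) x) summable_on UNIV" for k
  proof -
    obtain C where C: "\<And>x. cmod (g k x) \<le> C"
      using gb by blast
    show ?thesis
      by (rule summable_above[OF s geo_avg_pow_bounded[OF \<rho> C] geo_avg_pow_zero[OF g0]])
  qed
  have "(\<Sum>\<^sub>\<infinity>x. s powi x * (h 0 x - (geo_avg \<rho> ^^ n) (h n) x))
      = (\<Sum>\<^sub>\<infinity>x. \<Sum>k<n. s powi x * (geo_avg \<rho> ^^ k) (g k) x)"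
    unfolding geo_avg_pow_telescope[of \<rho> h, OF \<rho> h_bounded] g_def sum_distrib_left by (rule refl)
  also have "\<dots> = (\<Sum>k<n. \<Sum>\<^sub>\<infinity>x. s powi x * (geo_avg \<rho> ^^ k) (g k) x)"
  proof (induction n)
    case (Suc n)
    have "(\<lambda>x. \<Sum>k<n. s powi x * (geo_avg \<rho> ^^ k) (g k) x) summable_on UNIV"
      by (induction n) (simp_all add: summ summable_on_add)
    then show ?case
      by (simp add: Suc infsum_add summ)
  qed simp
  finally show ?thesis
    unfolding s_def[symmetric] sum_g .
qed

text \<open>The part of the transform of \<open>h k\<close> at or below the barrier, which converges
  for \<open>1 - \<rho> < cmod t\<close>. It serves as the potential for telescoping
  \<open>contrib\<close>.\<close>

definition lower_sum :: "complex \<Rightarrow> nat \<Rightarrow> complex" where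
  "lower_sum t k = (of_real \<rho> / ratio t) ^ k * (\<Sum>\<^sub>\<infinity>x\<in>{..a k}. (t / of_real (1 - \<rho>)) powi x * h k x)"

text \<open>The half-line transform of \<open>h k = P (h (k + 1))\<close> below \<open>a k\<close>
  has a boundary term containing \<open>gap k\<close>. Solving for it expresses
  \<open>contrib\<close> by the lower sums, a boundary weight and the strip between two
  barriers.\<close>

lemma contrib_eq:
  assumes t: "1 - \<rho> < cmod t" "t \<noteq> 1"
  defines "s \<equiv> t / of_real (1 - \<rho>)"
  shows "contrib t k = lower_sum t k - lower_sum t (Suc k)
    + (of_real \<rho> / ratio t) ^ k / ratio t * (s powi (a k) * wt \<rho> v k (a k + 1))
    - (of_real \<rho> / ratio t) ^ Suc k * (\<Sum>x\<in>{a (Suc k)<..a k}. s powi x * wt \<rho> v (Suc k) x)"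
proof -
  obtain C where C: "\<And>x. cmod (h (Suc k) x) \<le> C"
    using h_bounded by blast
  have t0: "t \<noteq> 0"
    using t \<rho> by auto
  have s: "1 < cmod s"
    using t \<rho> unfolding s_def norm_divide norm_of_real by simp
  have \<sigma>: "1 / s - of_real (1 - \<rho>) = ratio t" "ratio t \<noteq> 0"
    using t(2) t0 \<rho>_complex by (simp add: s_def ratio_def field_simps, simp add: ratio_def)
  define \<Phi> where "\<Phi> = (\<Sum>\<^sub>\<infinity>x\<in>{..a k}. s powi x * h k x)"
  define \<Phi>' where "\<Phi>' = (\<Sum>\<^sub>\<infinity>x\<in>{..a (Suc k)}. s powi x * h (Suc k) x)"
  define X where "X = t powi (a k + 1) / (1 - t)"
  define S where "S = (\<Sum>x\<in>{a (Suc k)<..a k}. s powi x * wt \<rho> v (Suc k) x)"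
  \<comment> \<open>On the strip between the barriers \<open>h (Suc k)\<close> is already the
    explicit weight.\<close>
  have "{..a k} = {..a (Suc k)} \<union> {a (Suc k)<..a k}"
    using a[of k] by auto
  then have "(\<Sum>\<^sub>\<infinity>x\<in>{..a k}. s powi x * h (Suc k) x)
      = \<Phi>' + (\<Sum>\<^sub>\<infinity>x\<in>{a (Suc k)<..a k}. s powi x * h (Suc k) x)"
    unfolding \<Phi>'_def by (simp only:) (rule infsum_Un_disjoint, auto intro: summable_below[OF s C])
  also have "(\<Sum>\<^sub>\<infinity>x\<in>{a (Suc k)<..a k}. s powi x * h (Suc k) x) = S"
    unfolding S_def by (simp add: h_above)
  finally have split: "(\<Sum>\<^sub>\<infinity>x\<in>{..a k}. s powi x * h (Suc k) x) = \<Phi>' + S" .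
  have "(\<Sum>\<^sub>\<infinity>x\<in>{..a k}. s powi x * geo_avg \<rho> (h (Suc k)) x) = \<Phi>"
    unfolding \<Phi>_def by (rule infsum_cong) (simp add: h_below)
  then have eq: "ratio t * \<Phi> + s powi (a k) * geo_avg \<rho> (h (Suc k)) (a k + 1) = of_real \<rho> * (\<Phi>' + S)"
    using geo_avg_transform_below[of \<rho> s "h (Suc k)" C "a k", OF \<rho> s C] \<sigma>(1) split by simp
  have "geo_avg \<rho> (h (Suc k)) (a k + 1) = wt \<rho> v k (a k + 1) - gap k * of_real (1 - \<rho>) powi (a k + 1)"
    using \<rho>_complex by (simp add: gap_def)
  then have "gap k * (s powi (a k) * of_real (1 - \<rho>) powi (a k + 1))
      = ratio t * \<Phi> - of_real \<rho> * \<Phi>' + s powi (a k) * wt \<rho> v k (a k + 1) - of_real \<rho> * S"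
    using eq by (simp only:) (simp add: algebra_simps)
  also have "s powi (a k) * of_real (1 - \<rho>) powi (a k + 1) = ratio t * X"
    unfolding X_def using \<rho>_complex t0 t by (simp add: s_def ratio_def power_int_divide_distrib power_int_add)
  finally have "gap k * X
      = (ratio t * \<Phi> - of_real \<rho> * \<Phi>' + s powi (a k) * wt \<rho> v k (a k + 1) - of_real \<rho> * S) / ratio t"
    using \<sigma>(2) by (simp add: nonzero_eq_divide_eq mult_ac)
  also have "\<dots> = \<Phi> - of_real \<rho> / ratio t * \<Phi>'
      + s powi (a k) * wt \<rho> v k (a k + 1) / ratio t - of_real \<rho> / ratio t * S"
    using \<sigma>(2) by (simp add: add_divide_distrib diff_divide_distrib)
  finally have gX: "gap k * X = \<dots>" .
  have "contrib t k = (of_real \<rho> / ratio t) ^ k * (gap k * X)"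
    by (simp add: contrib_def X_def)
  then have "contrib t k = (of_real \<rho> / ratio t) ^ k * (\<Phi> - of_real \<rho> / ratio t * \<Phi>'
      + s powi (a k) * wt \<rho> v k (a k + 1) / ratio t - of_real \<rho> / ratio t * S)"
    unfolding gX .
  then show ?thesis
    unfolding lower_sum_def s_def[symmetric] \<Phi>_def[symmetric] \<Phi>'_def[symmetric] S_def[symmetric]
    by (simp add: algebra_simps)
qed

lemma power_wt_Suc:
  assumes "1 - \<rho> < cmod t" "x = y + 1"
  shows "(t / of_real (1 - \<rho>)) powi x * wt \<rho> v k x
    = t / (v + 1) * ((t / of_real (1 - \<rho>)) powi y * wt \<rho> v k y)"
proof -
  have "t \<noteq> 0" using assms \<rho> by auto
  then show ?thesis
    using \<rho>_complex v assms(2) by (simp add: wt_def power_int_add power_int_divide_distrib power2_eq_square mult_ac)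
qed

text \<open>The lower sums telescope and agree at both ends by \<open>periodic\<close> and
  \<open>closing\<close>. The remaining terms are geometric in position with ratio
  \<open>t / (v + 1)\<close>: if it differs from 1 they telescope too, otherwise they count the time
  steps and the total drop of the barrier.\<close>

lemma sum_contrib:
  assumes t: "1 - \<rho> < cmod t" "t \<noteq> 1"
    and periodic: "\<And>x. h n x = \<kappa> * h 0 (x + (a 0 - a n))"
    and closing: "(of_real \<rho> / ratio t) ^ n * \<kappa> = (t / of_real (1 - \<rho>)) powi (a 0 - a n)"
  shows "(\<Sum>k<n. contrib t k)
    = (if t = v + 1 then - (of_nat n / v + of_int (a 0 - a n)) / (v + 1) else 0)"
proof -
  define s where "s = t / of_real (1 - \<rho>)"
  define e where "e = of_real \<rho> / ratio t"
  define \<beta> where "\<beta> = - v * of_real (1 - \<rho>) / ((v + 1) * of_real \<rho>)"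
  define U where "U k x = s powi x * wt \<rho> v k x" for k x
  have t0: "t \<noteq> 0"
    using t \<rho> by auto
  have s0: "s \<noteq> 0"
    using t0 \<rho>_complex by (simp add: s_def)
  have ratio0: "ratio t \<noteq> 0"
    using t0 t(2) \<rho>_complex by (simp add: ratio_def)
  have ratio_s: "ratio t * s = 1 - t"
    using t0 \<rho>_complex by (simp add: ratio_def s_def)
  have U_Suc: "U (Suc k) x = \<beta> * U k x" for k x
    by (simp add: U_def wt_Suc \<beta>_def)
  have U_step: "U k (x + 1) = t / (v + 1) * U k x" for k x
    unfolding U_def s_def by (rule power_wt_Suc[OF t(1) refl])
  have boundary: "s powi (a k) * wt \<rho> v k (a k + 1) = U k (a k + 1) / s" for k
    using s0 by (simp add: U_def power_int_add)
  have contrib: "contrib t k = lower_sum t k - lower_sum t (Suc k)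
      + e ^ k * U k (a k + 1) / (1 - t) - e ^ Suc k * (\<Sum>x\<in>{a (Suc k)<..a k}. U (Suc k) x)" for k
    unfolding contrib_eq[OF t, folded s_def e_def] boundary ratio_s[symmetric] U_def[symmetric]
    by (simp add: mult_ac)
  have closing': "e ^ n * \<kappa> = s powi (a 0 - a n)"
    using closing by (simp add: e_def s_def)
  have lower_n: "lower_sum t n = lower_sum t 0"
  proof -
    have "(\<Sum>\<^sub>\<infinity>x\<in>{..a n}. s powi x * h n x)
        = (\<Sum>\<^sub>\<infinity>x\<in>{..a 0}. \<kappa> * s powi (a n - a 0) * (s powi x * h 0 x))"
      by (rule infsum_reindex_bij_witness[where i = "\<lambda>x. x - (a 0 - a n)" and j = "\<lambda>x. x + (a 0 - a n)"])
        (use s0 in \<open>auto simp: periodic power_int_diff power_int_add\<close>)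
    then have "lower_sum t n = e ^ n * \<kappa> * s powi (a n - a 0) * (\<Sum>\<^sub>\<infinity>x\<in>{..a 0}. s powi x * h 0 x)"
      unfolding lower_sum_def e_def[symmetric] s_def[symmetric] infsum_cmult_right' by simp
    also have "e ^ n * \<kappa> * s powi (a n - a 0) = 1"
      using s0 by (simp add: closing' power_int_diff)
    finally show ?thesis
      by (simp add: lower_sum_def s_def)
  qed
  have telescope: "(\<Sum>k<n. f k - f (Suc k)) = f 0 - f n" for f :: "nat \<Rightarrow> complex"
    by (rule sum_lessThan_telescope')
  show ?thesis
  proof (cases "t = v + 1")
    case True
    \<comment> \<open>At \<open>t = v + 1\<close> the multiplier of \<open>P\<close> undoes the time
      factor of the weight, so all weighted terms are the same constant.\<close>
    have eb: "e * \<beta> = 1"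
      using v \<rho>_complex True by (simp add: e_def \<beta>_def ratio_def)
    have "U 0 x = 1 / (v + 1)" for x
      using v \<rho>_complex by (simp add: U_def s_def wt_def True power_int_divide_distrib power_int_add)
    then have eU: "e ^ k * U k x = 1 / (v + 1)" for k x
    proof (induction k)
      case (Suc k)
      have "e ^ Suc k * U (Suc k) x = e * \<beta> * (e ^ k * U k x)"
        by (simp add: U_Suc)
      then show ?case using Suc eb by simp
    qed simp
    have "contrib t k = (lower_sum t k - lower_sum t (Suc k))
        + (of_int (a (Suc k)) - of_int (a k) - 1 / v) / (v + 1)" for k
    proof -
      have "a (Suc k) \<le> a k"
        using a[of k] by simp
      then have "(\<Sum>x\<in>{a (Suc k)<..a k}. 1 / (v + 1)) = (of_int (a k) - of_int (a (Suc k))) / (v + 1)"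
        by simp
      moreover have "1 / (v + 1) / (1 - t) = - (1 / v) / (v + 1)"
        using v True by simp
      ultimately show ?thesis
        unfolding contrib sum_distrib_left eU by (simp add: diff_divide_distrib)
    qed
    then have "(\<Sum>k<n. contrib t k) = (\<Sum>k<n. lower_sum t k - lower_sum t (Suc k))
        - ((\<Sum>k<n. of_int (a k) - of_int (a (Suc k))) + of_nat n / v) / (v + 1)"
      by (simp add: sum.distrib sum_subtractf sum_divide_distrib[symmetric] diff_divide_distrib
          add_divide_distrib)
    then have "(\<Sum>k<n. contrib t k) = - ((of_int (a 0) - of_int (a n) + of_nat n / v) / (v + 1))"
      unfolding telescope[of "lower_sum t"] telescope[of "\<lambda>k. of_int (a k)"] lower_n
      by (simp only: diff_self diff_0)
    then show ?thesis
      unfolding of_int_diff add.commute[of "of_nat n / v"] minus_divide_left using True by (simp only: if_True simp_thms)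
  next
    case False
    let ?r = "t / (v + 1)"
    have r1: "?r \<noteq> 1"
      using False v by simp
    \<comment> \<open>The extra term combines the boundary weight with one end of the strip sum;
      \<open>key\<close> is the identity between their coefficients.\<close>
    define V where "V k = lower_sum t k + e ^ k * U k (a k + 1) / (1 - ?r)" for k
    have key: "1 / (1 - t) + e * \<beta> / (1 - ?r) = 1 / (1 - ?r)"
    proof -
      have "e * \<beta> = v * t / ((v + 1) * (t - 1))"
        using v \<rho>_complex t0 t(2) by (simp add: e_def \<beta>_def ratio_def divide_simps) (simp add: algebra_simps)
      then have "1 - e * \<beta> = (1 - ?r) / (1 - t)"
        using v t(2) by (simp only:) (simp add: divide_simps, simp add: algebra_simps)
      then have "(1 - e * \<beta>) / (1 - ?r) = 1 / (1 - t)"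
        using r1 by simp
      then show ?thesis
        by (simp add: diff_divide_distrib diff_eq_eq)
    qed
    have "contrib t k = V k - V (Suc k)" for k
    proof -
      have S: "(\<Sum>x\<in>{a (Suc k)<..a k}. U (Suc k) x)
          = (U (Suc k) (a (Suc k) + 1) - \<beta> * U k (a k + 1)) / (1 - ?r)"
        using sum_geometric_int[of "U (Suc k)" ?r "a (Suc k)" "a k", OF U_step r1] a[of k]
        by (simp add: U_Suc)
      have "e ^ k * U k (a k + 1) / (1 - t) = e ^ k * U k (a k + 1) * (1 / (1 - ?r) - e * \<beta> / (1 - ?r))"
        unfolding key[symmetric] by simp
      then show ?thesis
        unfolding contrib V_def S by (simp only:) (simp add: right_diff_distrib diff_divide_distrib mult_ac)
    qed
    then have "(\<Sum>k<n. contrib t k) = V 0 - V n"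
      using telescope[of V] by simp
    moreover have "V n = V 0"
    proof -
      \<comment> \<open>Periodicity is assumed for \<open>h\<close> alone. Just above the barrier
        \<open>h\<close> is the weight, which therefore inherits it.\<close>
      have "wt \<rho> v n (a n + 1) = \<kappa> * wt \<rho> v 0 (a 0 + 1)"
        using periodic[of "a n + 1"] h_above[of n "a n + 1"] h_above[of 0 "a 0 + 1"]
        by (simp add: algebra_simps)
      then have "e ^ n * U n (a n + 1) = e ^ n * \<kappa> * (s powi (a n + 1) * wt \<rho> v 0 (a 0 + 1))"
        by (simp add: U_def)
      also have "\<dots> = U 0 (a 0 + 1)"
        unfolding closing' U_def using s0 by (simp add: power_int_diff power_int_add)
      finally show ?thesis
        by (simp add: V_def lower_n)
    qed
    ultimately show ?thesis
      using False by simp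
  qed
qed

end

section \<open>Hitting values of the walk\<close>

text \<open>The common integrand of both expectations without the indicator of
  \<open>\<tau> < N\<close>; it is 0 on paths without a hit.\<close>

definition hit_value :: "real \<Rightarrow> complex \<Rightarrow> (int \<Rightarrow> int) \<Rightarrow> nat \<Rightarrow> (nat \<Rightarrow> int) \<Rightarrow> complex" where
  "hit_value \<rho> v Y n G =
    (if \<exists>m. n \<le> m \<and> Y (int m + 1) < G m
     then (\<lambda>m. wt \<rho> v m (G m)) (LEAST m. n \<le> m \<and> Y (int m + 1) < G m) else 0)"

lemma hit_time_eq:
  "hit_time Y n G = (if \<exists>m. n \<le> m \<and> Y (int m + 1) < G m
     then enat (LEAST m. n \<le> m \<and> Y (int m + 1) < G m) else \<infinity>)"
proof (cases "\<exists>m. n \<le> m \<and> Y (int m + 1) < G m")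
  case True
  let ?P = "\<lambda>m. n \<le> m \<and> Y (int m + 1) < G m"
  have "Inf (enat ` {m. ?P m}) = enat (LEAST m. ?P m)"
  proof (rule antisym)
    show "Inf (enat ` {m. ?P m}) \<le> enat (LEAST m. ?P m)"
      using LeastI_ex[OF True] by (intro Inf_lower) blast
    show "enat (LEAST m. ?P m) \<le> Inf (enat ` {m. ?P m})"
      by (rule Inf_greatest) (auto intro: Least_le)
  qed
  then show ?thesis
    using True by (simp add: hit_time_def)
next
  case False
  then have E: "{m. n \<le> m \<and> G m > Y (int m + 1)} = {}"
    by blast
  show ?thesis
    unfolding if_not_P[OF False] hit_time_def E by (simp add: top_enat_def)
qed

lemma hit_value_eq_hit_time:
  "hit_value \<rho> v Y n G = (if hit_time Y n G < \<infinity> then ch_weight \<rho> v G (the_enat (hit_time Y n G)) else 0)"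
  by (cases "\<exists>m. n \<le> m \<and> Y (int m + 1) < G m")
    (simp_all only: hit_value_def hit_time_eq ch_weight_eq_wt if_True if_False the_enat.simps
      enat_ord_simps less_irrefl enat.distinct simp_thms)

lemma hit_time_less:
  "hit_time Y 0 G < enat N \<longleftrightarrow> (\<exists>m<N. Y (int m + 1) < G m)"
proof
  assume "hit_time Y 0 G < enat N"
  then show "\<exists>m<N. Y (int m + 1) < G m"
    using LeastI_ex[of "\<lambda>m. Y (int m + 1) < G m"] by (auto simp: hit_time_eq split: if_splits)
next
  assume "\<exists>m<N. Y (int m + 1) < G m"
  then obtain m where "m < N" "Y (int m + 1) < G m"
    by blast
  then show "hit_time Y 0 G < enat N"
    using Least_le[of "\<lambda>m. Y (int m + 1) < G m" m] by (auto simp: hit_time_eq)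
qed

text \<open>Without an early hit, the first hits counted from \<open>0\<close> and from
  \<open>n\<close> coincide. This later removes the indicator of \<open>\<tau> < N\<close>.\<close>

lemma hit_value_before:
  assumes "\<not> (\<exists>m<n. Y (int m + 1) < G m)"
  shows "hit_value \<rho> v Y 0 G = hit_value \<rho> v Y n G"
proof -
  have "0 \<le> m \<and> Y (int m + 1) < G m \<longleftrightarrow> n \<le> m \<and> Y (int m + 1) < G m" for m
    using assms by (metis le0 not_le)
  then show ?thesis
    unfolding hit_value_def by simp
qed

text \<open>Path and barrier are both moved by one time unit, and the weight loses one time
  factor.\<close>

lemma hit_value_Suc:
  "hit_value \<rho> v Y (Suc n) G
    = (- v * of_real (1 - \<rho>) / ((v + 1) * of_real \<rho>)) * hit_value \<rho> v (\<lambda>i. Y (i + 1)) n (\<lambda>m. G (Suc m))"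
proof -
  let ?P = "\<lambda>m. Suc n \<le> m \<and> Y (int m + 1) < G m"
  have P: "?P (Suc m) \<longleftrightarrow> n \<le> m \<and> Y (int m + 1 + 1) < G (Suc m)" for m
    by (simp add: algebra_simps)
  have ex: "(\<exists>m. ?P m) \<longleftrightarrow> (\<exists>m. ?P (Suc m))"
    by (metis Suc_le_D)
  have "(LEAST m. ?P m) = Suc (LEAST m. ?P (Suc m))" if "\<exists>m. ?P m"
    using that Least_Suc[of ?P] by auto
  then show ?thesis
    unfolding hit_value_def using ex unfolding P by (auto simp: wt_Suc)
qed

lemma hit_value_0:
  "hit_value \<rho> v Y 0 G = (if Y 1 < G 0 then wt \<rho> v 0 (G 0) else hit_value \<rho> v Y 1 G)"
proof (cases "Y 1 < G 0")
  case True
  then have "(LEAST m. 0 \<le> m \<and> Y (int m + 1) < G m) = 0"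
    by (intro Least_equality) auto
  moreover have "\<exists>m. 0 \<le> m \<and> Y (int m + 1) < G m"
    using True by (intro exI[of _ 0]) simp
  ultimately show ?thesis
    using True by (simp only: hit_value_def if_True)
qed (use hit_value_before[of 1 Y G] in simp)

lemma hit_value_shift:
  assumes "\<And>m x. wt \<rho> v m x = c * wt \<rho> v m (x + l)"
  shows "hit_value \<rho> v (\<lambda>i. Y i - l) n G = c * hit_value \<rho> v Y n (\<lambda>m. G m + l)"
proof -
  have "Y (int m + 1) - l < G m \<longleftrightarrow> Y (int m + 1) < G m + l" for m
    by linarith
  then show ?thesis
    unfolding hit_value_def by (auto intro: assms)
qed

text \<open>One constant serves all times, because a hit may occur arbitrarily late.\<close>

definition hits_bounded :: "real \<Rightarrow> complex \<Rightarrow> (int \<Rightarrow> int) \<Rightarrow> real \<Rightarrow> bool" where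
  "hits_bounded \<rho> v Y C \<longleftrightarrow> (\<forall>m x. Y (int m + 1) < x \<longrightarrow> cmod (wt \<rho> v m x) \<le> C)"

lemma hits_bounded_nonneg: "hits_bounded \<rho> v Y C \<Longrightarrow> 0 \<le> C"
  unfolding hits_bounded_def by (meson lt_ex gt_ex norm_ge_zero order_trans)

lemma hit_value_bounded:
  assumes "hits_bounded \<rho> v Y C"
  shows "cmod (hit_value \<rho> v Y n G) \<le> C"
proof (cases "\<exists>m. n \<le> m \<and> Y (int m + 1) < G m")
  case True
  then show ?thesis
    using LeastI_ex[OF True] assms by (simp add: hit_value_def hits_bounded_def)
qed (use hits_bounded_nonneg[OF assms] in \<open>auto simp: hit_value_def\<close>)

section \<open>Measurability and means on the path space\<close>

lemma walk_measurable [measurable]: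
  "(\<lambda>\<omega>. walk x \<omega> m) \<in> measurable (walk_space \<rho>) (count_space UNIV)"
proof (induction m)
  case (Suc m)
  have c: "(\<lambda>\<omega>. \<omega> m) \<in> measurable (walk_space \<rho>) (count_space UNIV)"
    unfolding walk_space_def by (rule measurable_compose[OF measurable_component_singleton]) auto
  have "(\<lambda>\<omega>. i + j) \<in> measurable (walk_space \<rho>) (count_space UNIV)" for i j :: int
    by simp
  then have "(\<lambda>\<omega>. i + \<omega> m) \<in> measurable (walk_space \<rho>) (count_space UNIV)" for i
    by (rule measurable_compose_countable[OF _ c])
  then have "(\<lambda>\<omega>. walk x \<omega> m + \<omega> m) \<in> measurable (walk_space \<rho>) (count_space UNIV)"
    by (rule measurable_compose_countable[OF _ Suc])
  then show ?case
    by (simp add: walk_def algebra_simps)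
qed (simp add: walk_def)

lemma hit_value_measurable [measurable]:
  "(\<lambda>\<omega>. hit_value \<rho> v Y n (walk x \<omega>)) \<in> borel_measurable (walk_space \<rho>')"
proof -
  have "(\<lambda>\<omega>. wt \<rho> v m (walk x \<omega> m)) \<in> borel_measurable (walk_space \<rho>')" for m
    by (rule measurable_compose[OF walk_measurable]) simp
  then have "(\<lambda>\<omega>. (\<lambda>m. wt \<rho> v m (walk x \<omega> m)) (LEAST m. n \<le> m \<and> Y (int m + 1) < walk x \<omega> m))
      \<in> borel_measurable (walk_space \<rho>')"
    by (rule measurable_compose_countable) measurable
  then show ?thesis
    unfolding hit_value_def by measurable
qed

lemma prob_space_walk_space: "prob_space (walk_space \<rho>)"
  unfolding walk_space_def by (rule prob_space_PiM) (simp add: measure_pmf.prob_space_axioms)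

lemma integrable_hit_value:
  assumes "hits_bounded \<rho> v Y C"
  shows "integrable (walk_space \<rho>') (\<lambda>\<omega>. hit_value \<rho> v Y n (walk x \<omega>))"
proof -
  interpret prob_space "walk_space \<rho>'"
    by (rule prob_space_walk_space)
  show ?thesis
    by (rule integrable_const_bound[where B = C])
      (use hit_value_bounded[OF assms] in auto)
qed

text \<open>The walk starts at time 0 and \<open>n\<close> only delays the first admissible hit.
  Later starting times are expressed by shifting \<open>Y\<close>.\<close>

definition mean_hit :: "real \<Rightarrow> complex \<Rightarrow> (int \<Rightarrow> int) \<Rightarrow> nat \<Rightarrow> int \<Rightarrow> complex" where
  "mean_hit \<rho> v Y n x = (LINT \<omega>|walk_space \<rho>. hit_value \<rho> v Y n (walk x \<omega>))"

lemma norm_integral_walk_space_le: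
  fixes f :: "(nat \<Rightarrow> int) \<Rightarrow> complex"
  assumes "\<And>\<omega>. cmod (f \<omega>) \<le> C" "0 \<le> C"
  shows "cmod (LINT \<omega>|walk_space \<rho>. f \<omega>) \<le> C"
proof -
  interpret prob_space "walk_space \<rho>"
    by (rule prob_space_walk_space)
  show ?thesis
  proof (cases "integrable (walk_space \<rho>) f")
    case True
    have "cmod (LINT \<omega>|walk_space \<rho>. f \<omega>) \<le> (LINT \<omega>|walk_space \<rho>. cmod (f \<omega>))"
      by (rule integral_norm_bound)
    also have "\<dots> \<le> (LINT \<omega>|walk_space \<rho>. C)"
      using True by (intro integral_mono) (use assms in auto)
    finally show ?thesis
      by (simp add: prob_space)
  \<comment> \<open>The integral of a non-integrable function is 0 by convention, hence the use of
    \<open>0 \<le> C\<close>.\<close>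
  qed (simp add: not_integrable_integral_eq assms)
qed

lemma mean_hit_bounded:
  assumes "hits_bounded \<rho> v Y C"
  shows "cmod (mean_hit \<rho> v Y n x) \<le> C"
  unfolding mean_hit_def
  by (intro norm_integral_walk_space_le hit_value_bounded hits_bounded_nonneg) (use assms in auto)

lemma integral_walk_step:
  assumes "0 < \<rho>" "\<rho> < 1" "\<And>x. cmod (g x) \<le> C"
  shows "(LINT i|measure_pmf (walk_step \<rho>). g (x + i)) = geo_avg \<rho> g x"
proof -
  have p: "pmf (geometric_pmf \<rho>) n *\<^sub>R g (x + (- 1 - int n))
      = of_real (\<rho> * (1 - \<rho>) ^ n) * g (x - 1 - int n)" for n
    using assms by (simp add: scaleR_conv_of_real algebra_simps)
  have "(LINT i|measure_pmf (walk_step \<rho>). g (x + i))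
      = (LINT n|measure_pmf (geometric_pmf \<rho>). g (x + (- 1 - int n)))"
    unfolding walk_step_def by (simp add: integral_map_pmf)
  also have "\<dots> = (LINT n|count_space UNIV. pmf (geometric_pmf \<rho>) n *\<^sub>R g (x + (- 1 - int n)))"
    unfolding measure_pmf_eq_density by (subst integral_density) auto
  also have "\<dots> = geo_avg \<rho> g x"
    unfolding p geo_avg_def
    by (rule integral_count_space_nat)
      (use geo_avg_norm_summable[of \<rho> g C x, OF assms] in \<open>simp only: integrable_count_space_nat_iff\<close>)
  finally show ?thesis .
qed

text \<open>The increment space is the product of its first factor with a copy of itself, and Fubini
  applies because \<open>f\<close> is bounded.\<close>

lemma integral_walk_space_first_step:
  fixes f :: "(nat \<Rightarrow> int) \<Rightarrow> complex"
  assumes [measurable]: "f \<in> borel_measurable (walk_space \<rho>)" and b: "\<And>\<omega>. cmod (f \<omega>) \<le> C"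
  shows "(LINT \<omega>|walk_space \<rho>. f \<omega>)
    = (LINT i|measure_pmf (walk_step \<rho>). LINT \<omega>|walk_space \<rho>. f (case_nat i \<omega>))"
proof -
  interpret sequence_space "measure_pmf (walk_step \<rho>)"
    by standard
  interpret Q: pair_prob_space "measure_pmf (walk_step \<rho>)" S
    by (intro pair_prob_space.intro pair_sigma_finite.intro prob_space_imp_sigma_finite
        measure_pmf.prob_space_axioms prob_space_PiM)
  have S: "S = walk_space \<rho>"
    by (simp add: walk_space_def)
  have [measurable]: "f \<in> borel_measurable S"
    using assms(1) by (simp add: S)
  have "(LINT \<omega>|S. f \<omega>) = (LINT \<omega>|distr (measure_pmf (walk_step \<rho>) \<Otimes>\<^sub>M S) S (\<lambda>(s, \<omega>). case_nat s \<omega>). f \<omega>)"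
    unfolding PiM_iter ..
  also have "\<dots> = (LINT p|(measure_pmf (walk_step \<rho>) \<Otimes>\<^sub>M S). f (case p of (s, \<omega>) \<Rightarrow> case_nat s \<omega>))"
    by (rule integral_distr) measurable
  also have "\<dots> = (LINT i|measure_pmf (walk_step \<rho>). LINT \<omega>|S. f (case_nat i \<omega>))"
  proof -
    have "integrable (measure_pmf (walk_step \<rho>) \<Otimes>\<^sub>M S) (\<lambda>p. f (case p of (s, \<omega>) \<Rightarrow> case_nat s \<omega>))"
      by (rule Q.P.integrable_const_bound[where B = C]) (use b in auto)
    from Q.integral_fst'[OF this] show ?thesis
      by simp
  qed
  finally show ?thesis
    by (simp add: S)
qed

text \<open>Markov property at time 1: after the first increment the walk restarts against the
  barrier shifted by one index.\<close>

lemma mean_hit_Suc: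
  assumes "0 < \<rho>" "\<rho> < 1" "hits_bounded \<rho> v Y C" "hits_bounded \<rho> v (\<lambda>i. Y (i + 1)) C'"
  shows "mean_hit \<rho> v Y (Suc n) x
    = (- v * of_real (1 - \<rho>) / ((v + 1) * of_real \<rho>)) * geo_avg \<rho> (mean_hit \<rho> v (\<lambda>i. Y (i + 1)) n) x"
proof -
  let ?\<beta> = "- v * of_real (1 - \<rho>) / ((v + 1) * of_real \<rho>)"
  have w: "walk x (case_nat i \<omega>) (Suc m) = walk (x + i) \<omega> m" for i \<omega> m
    by (simp add: walk_def sum.lessThan_Suc_shift del: sum.lessThan_Suc)
  have "mean_hit \<rho> v Y (Suc n) x
      = (LINT i|measure_pmf (walk_step \<rho>). LINT \<omega>|walk_space \<rho>. hit_value \<rho> v Y (Suc n) (walk x (case_nat i \<omega>)))"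
    unfolding mean_hit_def
    by (rule integral_walk_space_first_step[OF _ hit_value_bounded[OF assms(3)]]) simp
  also have "\<dots> = (LINT i|measure_pmf (walk_step \<rho>). ?\<beta> * mean_hit \<rho> v (\<lambda>i. Y (i + 1)) n (x + i))"
    unfolding hit_value_Suc w mean_hit_def by (simp only: integral_mult_right_zero)
  also have "\<dots> = ?\<beta> * geo_avg \<rho> (mean_hit \<rho> v (\<lambda>i. Y (i + 1)) n) x"
    using integral_walk_step[of \<rho> "mean_hit \<rho> v (\<lambda>i. Y (i + 1)) n", OF assms(1,2) mean_hit_bounded[OF assms(4)]]
    by (simp only: integral_mult_right_zero)
  finally show ?thesis .
qed

lemma mean_hit_0:
  "mean_hit \<rho> v Y 0 x = (if Y 1 < x then wt \<rho> v 0 x else mean_hit \<rho> v Y 1 x)"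
proof -
  interpret prob_space "walk_space \<rho>"
    by (rule prob_space_walk_space)
  have "walk x \<omega> 0 = x" for \<omega>
    by (simp add: walk_def)
  then show ?thesis
    unfolding mean_hit_def hit_value_0 by (simp add: prob_space)
qed

lemma mean_hit_shift:
  assumes "\<And>m x. wt \<rho> v m x = c * wt \<rho> v m (x + l)"
  shows "mean_hit \<rho> v (\<lambda>i. Y i - l) n x = c * mean_hit \<rho> v Y n (x + l)"
proof -
  have "(\<lambda>m. walk x \<omega> m + l) = walk (x + l) \<omega>" for \<omega>
    by (simp add: walk_def fun_eq_iff)
  then show ?thesis
    unfolding mean_hit_def hit_value_shift[OF assms] by (simp only: integral_mult_right_zero)
qed

text \<open>This holds only almost surely, as the space contains all integer sequences. It supplies
  the left cutoff of the transforms.\<close>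

lemma walk_decreasing: "AE \<omega> in walk_space \<rho>. \<forall>m. walk x \<omega> m \<le> x"
proof -
  have "AE \<omega> in walk_space \<rho>. \<omega> i \<le> 0" for i
    unfolding walk_space_def
    by (rule AE_PiM_component) (auto simp: measure_pmf.prob_space_axioms AE_measure_pmf_iff walk_step_def)
  then have "AE \<omega> in walk_space \<rho>. \<forall>i. \<omega> i \<le> 0"
    by (simp add: AE_all_countable)
  then show ?thesis
    by eventually_elim (auto simp: walk_def intro: sum_nonpos)
qed

section \<open>Expansion of the probabilistic function\<close>

lemma PconfD:
  assumes "Y \<in> Pconf N L"
  shows "Y (i + 1) < Y i" "Y (i + int N) = Y i - int L"
  using assms by (auto simp: Pconf_def)

lemma Pconf_antimono:
  assumes "Y \<in> Pconf N L" "i \<le> j"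
  shows "Y j \<le> Y i"
  using assms(2)
proof (induction j rule: int_ge_induct)
  case (step j)
  then show ?case using PconfD(1)[OF assms(1), of j] by simp
qed simp

lemma norm_wt:
  assumes "0 < \<rho>" "\<rho> < 1" "v + 1 \<noteq> 0"
  shows "cmod (wt \<rho> v m x) = ((1 - \<rho>) / cmod (v + 1)) powi x / cmod (v + 1)
    * (cmod v * (1 - \<rho>) / (cmod (v + 1) * \<rho>)) ^ m"
  using assms unfolding wt_def norm_mult norm_divide norm_power norm_power_int norm_minus_cancel norm_of_real
  by (simp add: power_int_add power_int_divide_distrib)

text \<open>The weight decreases in \<open>x\<close>, so the barrier is the worst position. Over one
  period the bound there is multiplied by the quotient of the two sides of \<open>le\<close>, which
  is at most 1, so the first \<open>N\<close> times suffice.\<close>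

lemma hits_bounded_Pconf:
  assumes Y: "Y \<in> Pconf N L" and N: "0 < N" "N < L" and \<rho>: "0 < \<rho>" "\<rho> < 1"
    and v: "1 - \<rho> < cmod (v + 1)"
    and le: "cmod v ^ N * cmod (v + 1) ^ (L - N) \<le> \<rho> ^ N * (1 - \<rho>) ^ (L - N)"
  shows "\<exists>C. hits_bounded \<rho> v Y C"
proof -
  define q where "q = (1 - \<rho>) / cmod (v + 1)"
  define b where "b = cmod v * (1 - \<rho>) / (cmod (v + 1) * \<rho>)"
  \<comment> \<open>Evaluated at the barrier, one below the lowest hitting position; this is an
    upper bound because \<open>q \<le> 1\<close>.\<close>
  define F where "F m = q powi (Y (int m + 1)) * b ^ m" for m :: nat
  have v1: "v + 1 \<noteq> 0" "0 < cmod (v + 1)"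
    using v \<rho> by auto
  have q: "0 < q" "q \<le> 1" and b: "0 \<le> b"
    using \<rho> v v1(2) by (auto simp: q_def b_def)
  have F0: "0 \<le> F m" for m
    using q b by (simp add: F_def)
  have "q powi (- int L) * b ^ N \<le> 1"
  proof -
    obtain M where L: "L = N + M"
      using N by (metis less_imp_add_positive)
    have "q powi (- int L) * b ^ N = cmod v ^ N * cmod (v + 1) ^ M / (\<rho> ^ N * (1 - \<rho>) ^ M)"
      using \<rho> v1(2) unfolding L q_def b_def power_int_minus power_int_of_nat
      by (simp add: power_add power_divide power_mult_distrib divide_simps)
    also have "\<dots> \<le> 1"
      using le \<rho> by (simp add: L)
    finally show ?thesis .
  qed
  then have step: "F (m + N) \<le> F m" for m
  proof -
    have "F (m + N) = F m * (q powi (- int L) * b ^ N)"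
      using PconfD(2)[OF Y, of "int m + 1"] q(1)
      by (simp add: F_def power_add power_int_diff power_int_minus divide_inverse add_ac mult_ac)
    also have "\<dots> \<le> F m"
      using F0 \<open>q powi (- int L) * b ^ N \<le> 1\<close> by (rule mult_left_le[rotated])
    finally show ?thesis .
  qed
  have bound: "F m \<le> (\<Sum>r<N. F r)" for m
  proof (induction m rule: less_induct)
    case (less m)
    show ?case
    proof (cases "m < N")
      case True
      then show ?thesis
        using F0 by (intro member_le_sum) auto
    next
      case False
      then show ?thesis
        using less[of "m - N"] step[of "m - N"] N(1) by simp
    qed
  qed
  have "cmod (wt \<rho> v m x) \<le> (\<Sum>r<N. F r) / cmod (v + 1)" if "Y (int m + 1) < x" for m x
  proof -
    have "q powi x \<le> q powi (Y (int m + 1))"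
      using q that by (intro power_int_decreasing) auto
    then have "q powi x * b ^ m \<le> F m"
      unfolding F_def using b by (intro mult_right_mono) auto
    then have "q powi x * b ^ m / cmod (v + 1) \<le> (\<Sum>r<N. F r) / cmod (v + 1)"
      using bound[of m] by (intro divide_right_mono) auto
    then show ?thesis
      unfolding norm_wt[OF \<rho> v1(1)] q_def[symmetric] b_def[symmetric] by simp
  qed
  then show ?thesis
    unfolding hits_bounded_def by blast
qed

lemma Pconf_shift:
  assumes "Y \<in> Pconf N L"
  shows "(\<lambda>i. Y (i + k)) \<in> Pconf N L"
  unfolding Pconf_def
proof (intro CollectI allI conjI)
  fix i
  show "Y (i + 1 + k) < Y (i + k)"
    using PconfD(1)[OF assms, of "i + k"] by (simp add: add_ac)
  show "Y (i + int N + k) = Y (i + k) - int L"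
    using PconfD(2)[OF assms, of "i + k"] by (simp add: add_ac)
qed

definition beta :: "real \<Rightarrow> complex \<Rightarrow> complex" where
  "beta \<rho> v = - v * of_real (1 - \<rho>) / ((v + 1) * of_real \<rho>)"

text \<open>Iterates \<open>mean_hit_Suc\<close>. For \<open>k = n = N\<close> it identifies the
  subtracted term of \<open>pch\<close> with \<open>P ^ N (h N)\<close>.\<close>

lemma mean_hit_pow:
  assumes \<rho>: "0 < \<rho>" "\<rho> < 1" and b: "\<And>k. \<exists>C. hits_bounded \<rho> v (\<lambda>i. Y (i + int k)) C"
  shows "k \<le> n \<Longrightarrow> mean_hit \<rho> v Y n x
    = (geo_avg \<rho> ^^ k) (\<lambda>x. beta \<rho> v ^ k * mean_hit \<rho> v (\<lambda>i. Y (i + int k)) (n - k) x) x"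
proof (induction k)
  case (Suc k)
  let ?Y = "\<lambda>k i. Y (i + int k)"
  have Y: "(\<lambda>i. ?Y k (i + 1)) = ?Y (Suc k)"
    by (simp add: add_ac)
  obtain C C' where C: "hits_bounded \<rho> v (?Y k) C" "hits_bounded \<rho> v (?Y (Suc k)) C'"
    using b by metis
  have n: "n - k = Suc (n - Suc k)"
    using Suc by simp
  have "beta \<rho> v ^ k * mean_hit \<rho> v (?Y k) (n - k) x
      = geo_avg \<rho> (\<lambda>x. beta \<rho> v ^ Suc k * mean_hit \<rho> v (?Y (Suc k)) (n - Suc k) x) x" for x
  proof -
    have "mean_hit \<rho> v (?Y k) (n - k) x = beta \<rho> v * geo_avg \<rho> (mean_hit \<rho> v (?Y (Suc k)) (n - Suc k)) x"
      unfolding n beta_def using mean_hit_Suc[OF \<rho> C(1), unfolded Y, OF C(2)] .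
    then show ?thesis
      using geo_avg_cmult[of \<rho> "mean_hit \<rho> v (?Y (Suc k)) (n - Suc k)", OF \<rho> mean_hit_bounded[OF C(2)]]
      by simp
  qed
  then show ?case
    using Suc by (simp add: funpow_swap1)
qed simp

lemma summable_on_walk_transform:
  fixes f :: "int \<Rightarrow> (nat \<Rightarrow> int) \<Rightarrow> complex"
  assumes s: "s \<noteq> 0" "cmod s < 1"
    and b: "\<And>x \<omega>. cmod (f x \<omega>) \<le> C" "0 \<le> C"
    and low: "\<And>x \<omega>. x \<le> a \<Longrightarrow> (\<forall>m. walk x \<omega> m \<le> x) \<Longrightarrow> f x \<omega> = 0"
  shows "(\<lambda>x. s powi x * (LINT \<omega>|walk_space \<rho>. f x \<omega>)) summable_on UNIV"
proof (rule summable_above[OF s])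
  show "cmod (LINT \<omega>|walk_space \<rho>. f x \<omega>) \<le> C" for x
    by (rule norm_integral_walk_space_le) (use b in auto)
  show "(LINT \<omega>|walk_space \<rho>. f x \<omega>) = 0" if "x \<le> a" for x
  proof (rule integral_eq_zero_AE)
    show "AE \<omega> in walk_space \<rho>. f x \<omega> = 0"
      using walk_decreasing[where \<rho> = \<rho> and x = x] by eventually_elim (rule low[OF that])
  qed
qed

text \<open>On paths without a hit before time \<open>N\<close> both hit values agree, so the
  indicator of \<open>\<tau> < N\<close> disappears from the difference of the integrands.\<close>

lemma pch_eq_infsum:
  assumes N: "0 < N" and Y: "Y \<in> Pconf N L" and bd: "hits_bounded \<rho> v Y C"
    and u: "u + 1 \<noteq> 0" "cmod (u + 1) < 1 - \<rho>" and \<rho>: "0 < \<rho>" "\<rho> < 1"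
  shows "pch N Y \<rho> v u = (\<Sum>\<^sub>\<infinity>x. ((u + 1) / of_real (1 - \<rho>)) powi x
    * (mean_hit \<rho> v Y 0 x - mean_hit \<rho> v Y N x))"
proof -
  define s where "s = (u + 1) / of_real (1 - \<rho>)"
  define E where "E x \<omega> \<longleftrightarrow> (\<exists>m<N. Y (int m + 1) < walk x \<omega> m)" for x \<omega>
  define f where "f n x \<omega> = (if E x \<omega> then hit_value \<rho> v Y n (walk x \<omega>) else 0)" for n x \<omega>
  have s: "s \<noteq> 0" "cmod s < 1"
    using u \<rho> unfolding s_def norm_divide norm_of_real by auto
  have C0: "0 \<le> C"
    by (rule hits_bounded_nonneg[OF bd])
  have fb: "cmod (f n x \<omega>) \<le> C" for n x \<omega>
    using hit_value_bounded[OF bd] C0 by (simp add: f_def)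
  \<comment> \<open>Here the indicator makes each series converge separately: a decreasing path from
    \<open>Y N\<close> or lower never exceeds the first \<open>N\<close> barriers.\<close>
  have low: "f n x \<omega> = 0" if "x \<le> Y (int N)" "\<forall>m. walk x \<omega> m \<le> x" for n x \<omega>
  proof -
    have "walk x \<omega> m \<le> Y (int m + 1)" if "m < N" for m
      using Pconf_antimono[OF Y, of "int m + 1" "int N"] \<open>m < N\<close> \<open>x \<le> Y (int N)\<close> \<open>\<forall>m. walk x \<omega> m \<le> x\<close>[rule_format, of m]
      by linarith
    then have "\<not> E x \<omega>"
      unfolding E_def by (meson not_le)
    then show ?thesis
      by (simp add: f_def)
  qed
  have summ: "(\<lambda>x. s powi x * (LINT \<omega>|walk_space \<rho>. f n x \<omega>)) summable_on UNIV" for n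
    by (rule summable_on_walk_transform[OF s fb C0 low])
  have [measurable]: "(\<lambda>\<omega>. f n x \<omega>) \<in> borel_measurable (walk_space \<rho>)" for n x
    unfolding f_def E_def by measurable
  interpret prob_space "walk_space \<rho>"
    by (rule prob_space_walk_space)
  have fint: "integrable (walk_space \<rho>) (\<lambda>\<omega>. f n x \<omega>)" for n x
    by (rule integrable_const_bound[where B = C]) (use fb in auto)
  have ch: "ch N Y \<rho> v u = (\<Sum>\<^sub>\<infinity>x. s powi x * (LINT \<omega>|walk_space \<rho>. f 0 x \<omega>))"
  proof -
    have "(let G = walk x \<omega>; \<tau> = hit_time Y 0 G
         in if \<tau> < enat N then ch_weight \<rho> v G (the_enat \<tau>) else 0) = f 0 x \<omega>" for x \<omega>
      by (cases "hit_time Y 0 (walk x \<omega>)")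
        (simp_all add: Let_def f_def E_def hit_time_less[symmetric] hit_value_eq_hit_time)
    then show ?thesis
      unfolding ch_def s_def by presburger
  qed
  have ch_star: "ch_star N Y \<rho> v u = (\<Sum>\<^sub>\<infinity>x. s powi x * (LINT \<omega>|walk_space \<rho>. f N x \<omega>))"
  proof -
    have "(let G = walk x \<omega>; \<tau> = hit_time Y 0 G; \<tau>' = hit_time Y N G
         in if \<tau> < enat N \<and> \<tau>' < \<infinity> then ch_weight \<rho> v G (the_enat \<tau>') else 0) = f N x \<omega>" for x \<omega>
      unfolding Let_def f_def E_def hit_time_less[symmetric] hit_value_eq_hit_time by simp
    then show ?thesis
      unfolding ch_star_def s_def by presburger
  qed
  have "f 0 x \<omega> - f N x \<omega> = hit_value \<rho> v Y 0 (walk x \<omega>) - hit_value \<rho> v Y N (walk x \<omega>)" for x \<omega>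
    using hit_value_before[of N Y "walk x \<omega>" \<rho> v] by (auto simp: f_def E_def)
  then have diff: "(LINT \<omega>|walk_space \<rho>. f 0 x \<omega>) - (LINT \<omega>|walk_space \<rho>. f N x \<omega>)
      = mean_hit \<rho> v Y 0 x - mean_hit \<rho> v Y N x" for x
    unfolding mean_hit_def
    by (simp add: Bochner_Integration.integral_diff[OF fint fint, symmetric]
        Bochner_Integration.integral_diff[OF integrable_hit_value[OF bd] integrable_hit_value[OF bd], symmetric])
  have "pch N Y \<rho> v u = (\<Sum>\<^sub>\<infinity>x. s powi x * (LINT \<omega>|walk_space \<rho>. f 0 x \<omega>)
      - s powi x * (LINT \<omega>|walk_space \<rho>. f N x \<omega>))"
    unfolding pch_def ch ch_star
    using infsum_add[of _ UNIV "\<lambda>x. - (s powi x * (LINT \<omega>|walk_space \<rho>. f N x \<omega>))", OF summ[of 0]] summ[of N]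
    by (simp add: infsum_uminus summable_on_uminus)
  then show ?thesis
    unfolding right_diff_distrib[symmetric] diff s_def .
qed

section \<open>Expansion in the column functions of the determinant\<close>

definition GY_entry :: "(int \<Rightarrow> int) \<Rightarrow> nat \<Rightarrow> complex \<Rightarrow> complex" where
  "GY_entry Y k w = w powi (- (int k + 1)) * (w + 1) powi (Y (int k + 1) + (int k + 1))"

text \<open>With \<open>t = w + 1\<close> the multiplier is a constant times
  \<open>(w + 1) / w\<close>, and \<open>1 - t = - w\<close> supplies the last power of
  \<open>w\<close>. The coefficient does not depend on \<open>w\<close>.\<close>

lemma (in hitting_values) contrib_eq_GY_entry:
  assumes "w \<noteq> 0" "w + 1 \<noteq> 0" "a k = Y (int k + 1)"
  shows "contrib (w + 1) k = - gap k * (- of_real \<rho> / of_real (1 - \<rho>)) ^ k * GY_entry Y k w"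
proof -
  have r: "of_real \<rho> / ratio (w + 1) = (- of_real \<rho> / of_real (1 - \<rho>)) * ((w + 1) / w)"
    using assms \<rho>_complex by (simp add: ratio_def divide_simps)
  have e: "((w + 1) / w) ^ k * ((w + 1) powi (a k + 1) / (1 - (w + 1)))
      = - (w powi (- (int k + 1)) * (w + 1) powi (a k + (int k + 1)))"
  proof -
    have "w powi (- (int k + 1)) = inverse (w * w ^ k)"
      unfolding of_nat_Suc[symmetric, unfolded add.commute[of 1]] power_int_minus power_int_of_nat by simp
    then show ?thesis
      using assms(1,2) by (simp add: power_divide power_int_add divide_simps mult_ac)
  qed
  have "contrib (w + 1) k = gap k * (- of_real \<rho> / of_real (1 - \<rho>)) ^ k
      * (((w + 1) / w) ^ k * ((w + 1) powi (a k + 1) / (1 - (w + 1))))"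
    unfolding contrib_def r power_mult_distrib by (simp only: mult.assoc)
  then show ?thesis
    unfolding e GY_entry_def assms(3)[symmetric] by (simp only: mult_minus_left mult_minus_right)
qed

text \<open>One family \<open>d\<close>, depending on \<open>v\<close> but not on the point, serves
  both regions: near \<open>-1\<close> the transform converges, and for
  \<open>1 - \<rho> < cmod (w + 1)\<close> the sum over a period is evaluated by
  \<open>sum_contrib\<close>.\<close>

lemma pch_expansion:
  assumes N: "0 < N" "N < L" and Y: "Y \<in> Pconf N L" and \<rho>: "0 < \<rho>" "\<rho> < 1"
    and v: "v \<noteq> 0" "1 - \<rho> < cmod (v + 1)"
    and le: "cmod v ^ N * cmod (v + 1) ^ (L - N) \<le> \<rho> ^ N * (1 - \<rho>) ^ (L - N)"
  obtains d where
    "\<And>u. u + 1 \<noteq> 0 \<Longrightarrow> cmod (u + 1) < 1 - \<rho> \<Longrightarrow> pch N Y \<rho> v u = (\<Sum>k<N. d k * GY_entry Y k u)"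
    "\<And>w. w \<noteq> 0 \<Longrightarrow> 1 - \<rho> < cmod (w + 1) \<Longrightarrow>
      w ^ N * (w + 1) ^ (L - N) = v ^ N * (v + 1) ^ (L - N) \<Longrightarrow>
      (\<Sum>k<N. d k * GY_entry Y k w) = (if w = v then - (of_nat N / v + of_nat L) / (v + 1) else 0)"
proof -
  let ?Y = "\<lambda>k i. Y (i + int k)"
  define a where "a k = Y (int k + 1)" for k
  \<comment> \<open>A start at time \<open>k\<close> is a start at time 0 against the shifted
    barrier, with \<open>beta \<rho> v ^ k\<close> restoring the elapsed time.\<close>
  define h where "h k = (\<lambda>x. beta \<rho> v ^ k * mean_hit \<rho> v (?Y k) 0 x)" for k
  have v1: "v + 1 \<noteq> 0"
    using v \<rho> by auto
  have bd: "\<exists>C. hits_bounded \<rho> v (?Y k) C" for k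
    by (rule hits_bounded_Pconf[OF Pconf_shift[OF Y] N \<rho> v(2) le])
  interpret hitting_values \<rho> v a h
  proof
    fix k x
    show "a (Suc k) < a k"
      using PconfD(1)[OF Y, of "int k + 1"] by (simp add: a_def add_ac)
    obtain C where C: "hits_bounded \<rho> v (?Y k) C"
      using bd by blast
    have "cmod (h k x) \<le> cmod (beta \<rho> v ^ k) * C" for x
      unfolding h_def norm_mult by (intro mult_left_mono mean_hit_bounded[OF C]) auto
    then show "\<exists>C. \<forall>x. cmod (h k x) \<le> C"
      by blast
    have k1: "?Y k 1 = a k"
      by (simp add: a_def add_ac)
    show "h k x = wt \<rho> v k x" if "a k < x"
      using that k1 by (simp add: h_def mean_hit_0[of \<rho> v "?Y k"] wt_def beta_def)
    show "h k x = geo_avg \<rho> (h (Suc k)) x" if "x \<le> a k"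
    proof -
      have "mean_hit \<rho> v (?Y k) 0 x = mean_hit \<rho> v (?Y k) 1 x"
        using that k1 by (simp add: mean_hit_0[of \<rho> v "?Y k"])
      also have "\<dots> = geo_avg \<rho> (\<lambda>x. beta \<rho> v * mean_hit \<rho> v (?Y (Suc k)) 0 x) x"
        using mean_hit_pow[of \<rho> v "?Y k" 1 1 x, OF \<rho>] bd[of "k + _"] by (simp add: add_ac)
      finally have "h k x = beta \<rho> v ^ k * geo_avg \<rho> (\<lambda>x. beta \<rho> v * mean_hit \<rho> v (?Y (Suc k)) 0 x) x"
        by (simp add: h_def)
      also have "\<dots> = geo_avg \<rho> (\<lambda>x. beta \<rho> v ^ k * (beta \<rho> v * mean_hit \<rho> v (?Y (Suc k)) 0 x)) x"
      proof -
        obtain C where C: "hits_bounded \<rho> v (?Y (Suc k)) C"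
          using bd by blast
        have "cmod (beta \<rho> v * mean_hit \<rho> v (?Y (Suc k)) 0 x) \<le> cmod (beta \<rho> v) * C" for x
          unfolding norm_mult by (intro mult_left_mono mean_hit_bounded[OF C]) auto
        then show ?thesis
          by (rule geo_avg_cmult[OF \<rho>, symmetric])
      qed
      finally show ?thesis
        by (simp add: h_def mult_ac)
    qed
  qed (use \<rho> v v1 in auto)
  define d where "d k = - gap k * (- of_real \<rho> / of_real (1 - \<rho>)) ^ k" for k
  have contrib: "contrib (w + 1) k = d k * GY_entry Y k w" if "w \<noteq> 0" "w + 1 \<noteq> 0" for k w
    using contrib_eq_GY_entry[OF that, of k Y] by (simp add: d_def a_def)
  \<comment> \<open>One period costs \<open>N\<close> time factors and a translation by
    \<open>L\<close>, under which the weight scales exponentially.\<close>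
  define \<kappa> where "\<kappa> = beta \<rho> v ^ N * ((v + 1) / of_real (1 - \<rho>)) ^ L"
  have period: "a 0 - a N = int L"
    using PconfD(2)[OF Y, of 1] by (simp add: a_def add_ac)
  have periodic: "h N x = \<kappa> * h 0 (x + (a 0 - a N))" for x
  proof -
    have "wt \<rho> v m x = ((v + 1) / of_real (1 - \<rho>)) ^ L * wt \<rho> v m (x + int L)" for m x
      using v1 \<rho>_complex by (simp add: wt_def power_int_add power_divide)
    from mean_hit_shift[OF this]
    have "mean_hit \<rho> v (\<lambda>i. Y i - int L) 0 x
        = ((v + 1) / of_real (1 - \<rho>)) ^ L * mean_hit \<rho> v Y 0 (x + int L)" .
    then show ?thesis
      unfolding period h_def \<kappa>_def PconfD(2)[OF Y] by simp
  qed
  show ?thesis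
  proof
    fix u :: complex
    assume u: "u + 1 \<noteq> 0" "cmod (u + 1) < 1 - \<rho>"
    then have u0: "u \<noteq> 0"
      using \<rho> by auto
    obtain C where C: "hits_bounded \<rho> v Y C"
      using bd[of 0] by auto
    have "mean_hit \<rho> v Y 0 x - mean_hit \<rho> v Y N x = h 0 x - (geo_avg \<rho> ^^ N) (h N) x" for x
      using mean_hit_pow[of \<rho> v Y N N x, OF \<rho> bd] by (simp add: h_def)
    then have "pch N Y \<rho> v u = (\<Sum>k<N. contrib (u + 1) k)"
      using pch_eq_infsum[OF N(1) Y C u \<rho>] transform_defects[OF u, of N] by simp
    then show "pch N Y \<rho> v u = (\<Sum>k<N. d k * GY_entry Y k u)"
      using contrib[OF u0 u(1)] by simp
  next
    fix w :: complex
    assume w: "w \<noteq> 0" "1 - \<rho> < cmod (w + 1)"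
      and eq: "w ^ N * (w + 1) ^ (L - N) = v ^ N * (v + 1) ^ (L - N)"
    have w1: "w + 1 \<noteq> 0"
      using w \<rho> by auto
    \<comment> \<open>The closing condition of \<open>sum_contrib\<close> is the equation
      \<open>eq\<close> between \<open>w\<close> and \<open>v\<close>.\<close>
    have "(of_real \<rho> / ratio (w + 1)) ^ N * \<kappa> = ((w + 1) / of_real (1 - \<rho>)) ^ L"
    proof -
      obtain M where L: "L = N + M"
        using N(2) by (metis less_imp_add_positive)
      have "of_real \<rho> / ratio (w + 1) * beta \<rho> v = (v * (w + 1)) / (w * (v + 1))"
        using w w1 v1 \<rho>_complex by (simp add: ratio_def beta_def divide_simps)
      then have "(of_real \<rho> / ratio (w + 1)) ^ N * \<kappa>
          = ((v * (w + 1)) / (w * (v + 1))) ^ N * ((v + 1) / of_real (1 - \<rho>)) ^ L"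
        unfolding \<kappa>_def by (metis mult.assoc power_mult_distrib)
      also have "\<dots> = (v ^ N * (v + 1) ^ M) * (w + 1) ^ N / (w ^ N * of_real (1 - \<rho>) ^ L)"
        using w w1 v1 \<rho>_complex by (simp add: L power_mult_distrib power_divide power_add divide_simps)
      also have "\<dots> = ((w + 1) / of_real (1 - \<rho>)) ^ L"
      proof -
        have "v ^ N * (v + 1) ^ M = w ^ N * (w + 1) ^ M"
          using eq by (simp add: L)
        then show ?thesis
          using w by (simp only:) (simp add: L power_divide power_add divide_simps)
      qed
      finally show ?thesis .
    qed
    then have "(\<Sum>k<N. contrib (w + 1) k)
        = (if w + 1 = v + 1 then - (of_nat N / v + of_int (a 0 - a N)) / (v + 1) else 0)"
      using w(1) by (intro sum_contrib[OF w(2) _ periodic]) (simp_all add: period)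
    then show "(\<Sum>k<N. d k * GY_entry Y k w) = (if w = v then - (of_nat N / v + of_nat L) / (v + 1) else 0)"
      using contrib[OF w(1) w1] by (simp add: period)
  qed
qed

section \<open>Exchanging a row of the determinants\<close>

text \<open>Cramer's rule without division: multiply the system, whose right side is supported in
  row \<open>p\<close>, by the adjugate.\<close>

lemma adj_mat_solution:
  fixes A :: "'a :: comm_ring_1 mat"
  assumes A: "A \<in> carrier_mat n n" and p: "p < n" and k: "k < n"
    and d: "\<And>i. i < n \<Longrightarrow> (\<Sum>j<n. d j * A $$ (i, j)) = (if i = p then e else 0)"
  shows "Determinant.det A * d k = e * cofactor A p k"
proof -
  have adj: "(\<Sum>i<n. cofactor A i k * A $$ (i, j)) = (if k = j then Determinant.det A else 0)" if "j < n" for j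
  proof -
    have "(adj_mat A * A) $$ (k, j) = (\<Sum>i<n. cofactor A i k * A $$ (i, j))"
      using A k that by (auto simp: times_mat_def scalar_prod_def adj_mat_def atLeast0LessThan intro: sum.cong)
    then show ?thesis
      using adj_mat(3)[OF A] k that by (cases "k = j") simp_all
  qed
  have "e * cofactor A p k = (\<Sum>i<n. cofactor A i k * (if i = p then e else 0))"
    using p by (simp add: if_distrib mult.commute cong: if_cong)
  also have "\<dots> = (\<Sum>i<n. cofactor A i k * (\<Sum>j<n. d j * A $$ (i, j)))"
    by (rule sum.cong) (simp_all add: d)
  also have "\<dots> = (\<Sum>j<n. d j * (\<Sum>i<n. cofactor A i k * A $$ (i, j)))"
    unfolding sum_distrib_left by (subst sum.swap) (simp add: mult_ac)
  also have "\<dots> = (\<Sum>j<n. d j * (if k = j then Determinant.det A else 0))"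
    by (rule sum.cong) (simp_all add: adj)
  also have "\<dots> = Determinant.det A * d k"
    using k by (simp add: if_distrib mult.commute cong: if_cong)
  finally show ?thesis ..
qed

text \<open>Expand along row \<open>p\<close>: its cofactors ignore the exchanged row, and
  \<open>adj_mat_solution\<close> expresses them by \<open>d\<close>. It is applied to numerator and
  denominator of \<open>GY\<close> alike.\<close>

lemma det_row_exchange:
  fixes f :: "nat \<Rightarrow> 'b \<Rightarrow> 'a :: comm_ring_1"
  assumes n: "length ws = n" and p: "p < n"
    and d: "\<And>i. i < n \<Longrightarrow> (\<Sum>k<n. d k * f k (ws ! i)) = (if i = p then e else 0)"
  shows "e * Determinant.det (Matrix.mat n n (\<lambda>(i, j). f j (ws[p := u] ! i)))
    = (\<Sum>k<n. d k * f k u) * Determinant.det (Matrix.mat n n (\<lambda>(i, j). f j (ws ! i)))"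
proof -
  let ?A = "Matrix.mat n n (\<lambda>(i, j). f j (ws ! i))" and ?B = "Matrix.mat n n (\<lambda>(i, j). f j (ws[p := u] ! i))"
  have cof: "cofactor ?B p k = cofactor ?A p k" for k
  proof -
    have "mat_delete ?B p k = mat_delete ?A p k"
      by (rule eq_matI) (auto simp: mat_delete_def n)
    then show ?thesis
      by (simp add: cofactor_def)
  qed
  have "e * Determinant.det ?B = (\<Sum>k<n. f k u * (e * cofactor ?A p k))"
    using p n by (subst laplace_expansion_row[of _ n p]) (simp_all add: cof sum_distrib_left mult_ac)
  also have "\<dots> = (\<Sum>k<n. f k u * (Determinant.det ?A * d k))"
    by (rule sum.cong) (use p d in \<open>simp_all add: adj_mat_solution[of ?A n p _ d e]\<close>)
  finally show ?thesis
    by (simp add: sum_distrib_right mult_ac)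
qed

text \<open>Clearing denominators turns \<open>\<Prod>a\<in>S. w - a\<close> into a combination of the functions in the
  denominator of \<open>GY_list\<close>, so that the Vandermonde determinants can be compared
  by the same row exchange.\<close>

lemma prod_linear_factors_expansion:
  fixes S :: "complex set"
  assumes "finite S" "card S < n"
  obtains d where "\<And>w. w \<noteq> 0 \<Longrightarrow> (\<Prod>a\<in>S. w - a) / w ^ n = (\<Sum>k<n. d k * w powi (- (int k + 1)))"
proof
  fix w :: complex
  assume w: "w \<noteq> 0"
  let ?p = "\<Prod>a\<in>S. [:- a, 1:]"
  have "degree ?p < n"
    using assms degree_prod_sum_le[OF assms(1), of "\<lambda>a. [:- a, 1:]"] by simp
  then have "poly ?p w = (\<Sum>i<n. coeff ?p i * w ^ i)"
    unfolding poly_altdef by (intro sum.mono_neutral_left) (auto simp: coeff_eq_0)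
  then have "(\<Prod>a\<in>S. w - a) / w ^ n = (\<Sum>i<n. coeff ?p i * w ^ i / w ^ n)"
    by (simp add: poly_prod sum_divide_distrib)
  \<comment> \<open>Degree \<open>n - Suc k\<close> divided by \<open>w ^ n\<close> gives the
    exponent of column \<open>k\<close>.\<close>
  also have "\<dots> = (\<Sum>k<n. coeff ?p (n - Suc k) * w ^ (n - Suc k) / w ^ n)"
    by (rule sum.nat_diff_reindex[symmetric])
  also have "\<dots> = (\<Sum>k<n. coeff ?p (n - Suc k) * w powi (- (int k + 1)))"
  proof (rule sum.cong)
    fix k assume "k \<in> {..<n}"
    then obtain m where n: "n = m + Suc k"
      by (metis lessThan_iff less_iff_Suc_add add_Suc_right add.commute)
    have "w powi (- int (Suc k)) = w ^ m / w ^ n"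
      using w unfolding n power_int_minus power_int_of_nat by (simp add: power_add divide_simps)
    then show "coeff ?p (n - Suc k) * w ^ (n - Suc k) / w ^ n = coeff ?p (n - Suc k) * w powi (- (int k + 1))"
      by (simp add: n add_ac)
  qed simp
  finally show "(\<Prod>a\<in>S. w - a) / w ^ n
      = (\<Sum>k<n. coeff ?p (n - Suc k) * w powi (- (int k + 1)))" .
qed

section \<open>Comparison of the two functions through determinants\<close>

theorem theorem5p6:
  fixes N L :: nat and z :: complex and Y :: "int \<Rightarrow> int" and \<rho> :: real
  assumes "0 < N" and "N < L"
    and "0 < cmod z" and "cmod z < rNL N L"
    and "Y \<in> Pconf N L"
    and "0 < \<rho>" and "\<rho> < 1"
    and "r1 N L z < \<rho>" and "\<rho> < 1 - r2 N L z"
    and "\<rho> ^ N * (1 - \<rho>) ^ (L - N) > cmod z ^ L"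
    and "EY N L Y z \<noteq> 0"
  shows "\<forall>v \<in> right_roots N L z. \<forall>u :: complex.
           0 < cmod (u + 1) \<and> cmod (u + 1) < 1 - \<rho> \<longrightarrow>
             pch_norm N L Y v u z = pch N Y \<rho> v u"
proof (intro ballI allI impI)
  fix v u :: complex
  assume v: "v \<in> right_roots N L z" and u: "0 < cmod (u + 1) \<and> cmod (u + 1) < 1 - \<rho>"
  note N = assms(1,2) and \<rho> = assms(6,7)
  let ?R = "right_roots N L z"
  have z: "z \<noteq> 0"
    using assms(3) by auto
  have R_bound: "cmod w < \<rho>" "w \<noteq> 0" "1 - \<rho> < cmod (w + 1)"
    "w ^ N * (w + 1) ^ (L - N) = z ^ L" if "w \<in> ?R" for w
  proof -
    show *: "cmod w < \<rho>"
      by (rule right_roots_bound[OF N assms(8) that])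
    have q: "qz N L z w = 0"
      using that by (simp add: right_roots_def)
    then show "w \<noteq> 0" "w ^ N * (w + 1) ^ (L - N) = z ^ L"
      using qz_root_nonzero[OF N z] by (auto simp: qz_def)
    show "1 - \<rho> < cmod (w + 1)"
      using norm_triangle_ineq4[of "w + 1" w] * by simp
  qed
  have u0: "u + 1 \<noteq> 0" "cmod (u + 1) < 1 - \<rho>"
    using u by auto
  \<comment> \<open>So \<open>u\<close> lies outside the disc of the right roots, and replacing
    \<open>v\<close> by \<open>u\<close> keeps \<open>N\<close> distinct nonzero points.\<close>
  have "\<rho> < cmod u"
    using norm_triangle_ineq4[of "u + 1" u] u by simp
  then have uR: "u \<notin> ?R" and un: "u \<noteq> 0"
    using R_bound(1)[of u] \<rho>(1) by (meson less_asym, force)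
  have v1: "v + 1 \<noteq> 0"
    using R_bound(3)[OF v] \<rho> by auto
  \<comment> \<open>The cardinality gives the determinants the size \<open>N\<close> of the
    expansion.\<close>
  have fin: "finite ?R" and card: "card ?R = N"
    using finite_qz_roots[OF N] card_right_roots[OF N z assms(4) \<rho> assms(8,9,10)] by auto
  obtain ws where ws: "set ws = ?R" "distinct ws"
    using finite_distinct_list[OF fin] by blast
  then have len: "length ws = N"
    using card distinct_card by metis
  obtain p where p: "p < N" "ws ! p = v"
    using v ws(1) len by (metis in_set_conv_nth)
  let ?ws = "ws[p := u]"
  have ws': "set ?ws = ?R \<union> {u} - {v}" "distinct ?ws"
    using set_update_distinct[OF ws(2), of p u] p len ws uR v by (auto simp: distinct_list_update)
  have nth: "ws ! i \<in> ?R" "ws ! i = v \<longleftrightarrow> i = p" if "i < N" for i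
    using that p(1) nth_mem[of i ws] nth_eq_iff_index_eq[OF ws(2), of i p] by (simp_all add: p(2) ws(1) len)

  define A where "A xs = Determinant.det (Matrix.mat N N (\<lambda>(i, j). GY_entry Y j (xs ! i)))" for xs
  define V where "V xs = Determinant.det (Matrix.mat N N (\<lambda>(i, j). (xs ! i) powi (- (int j + 1))))" for xs :: "complex list"
  have GY_list: "GY_list Y xs = A xs / V xs" if "length xs = N" for xs
    by (simp add: GY_list_def A_def V_def that GY_entry_def)
  have GY: "GY Y ?R = A ws / V ws" "GY Y (?R \<union> {u} - {v}) = A ?ws / V ?ws"
    using GY_set[OF ws(2), of Y] GY_set[OF ws'(2), of Y] by (simp_all add: ws ws' GY_list len)
  \<comment> \<open>Division by 0 yields 0, so a nonzero quotient has both determinants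
    nonzero.\<close>
  have nz: "A ws \<noteq> 0" "V ws \<noteq> 0"
    using assms(11) by (auto simp: EY_def GY)

  define e where "e = - (of_nat N / v + of_nat L) / (v + 1)"
  have A': "e * A ?ws = pch N Y \<rho> v u * A ws"
  proof -
    have le: "cmod v ^ N * cmod (v + 1) ^ (L - N) \<le> \<rho> ^ N * (1 - \<rho>) ^ (L - N)"
      using qz_root_norm[of N L z v] v assms(10) by (simp add: right_roots_def)
    obtain d where d': "\<And>u. u + 1 \<noteq> 0 \<Longrightarrow> cmod (u + 1) < 1 - \<rho> \<Longrightarrow>
        pch N Y \<rho> v u = (\<Sum>k<N. d k * GY_entry Y k u)"
      "\<And>w. w \<noteq> 0 \<Longrightarrow> 1 - \<rho> < cmod (w + 1) \<Longrightarrow>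
        w ^ N * (w + 1) ^ (L - N) = v ^ N * (v + 1) ^ (L - N) \<Longrightarrow>
        (\<Sum>k<N. d k * GY_entry Y k w) = (if w = v then e else 0)"
      by (rule pch_expansion[OF N assms(5) \<rho> R_bound(2,3)[OF v] le, folded e_def]) blast
    have d: "pch N Y \<rho> v u = (\<Sum>k<N. d k * GY_entry Y k u)"
      "\<And>w. w \<in> ?R \<Longrightarrow> (\<Sum>k<N. d k * GY_entry Y k w) = (if w = v then e else 0)"
      by (rule d'(1)[OF u0]) (rule d'(2), simp_all only: R_bound v not_False_eq_True)
    show ?thesis
      unfolding A_def d(1) by (rule det_row_exchange[OF len p(1)]) (simp add: d(2) nth)
  qed
  define Q where "Q w = (\<Prod>v'\<in>?R - {v}. w - v')" for w
  \<comment> \<open>The row exchange for the Vandermonde part uses \<open>Q w / w ^ N\<close>, which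
    vanishes at every right root but \<open>v\<close>.\<close>
  have V': "Q v / v ^ N * V ?ws = Q u / u ^ N * V ws"
  proof -
    have "card (?R - {v}) < N"
      using card v fin N by simp
    from prod_linear_factors_expansion[OF finite_Diff[OF fin] this]
    obtain d where d: "\<And>w. w \<noteq> 0 \<Longrightarrow> Q w / w ^ N = (\<Sum>k<N. d k * w powi (- (int k + 1)))"
      unfolding Q_def by blast
    have "Q w = 0" if "w \<in> ?R" "w \<noteq> v" for w
      using that fin by (auto simp: Q_def)
    then have "(\<Sum>k<N. d k * (ws ! i) powi (- (int k + 1))) = (if i = p then Q v / v ^ N else 0)" if "i < N" for i
      unfolding d[OF R_bound(2)[OF nth(1)[OF that]], symmetric] using nth[OF that] by auto
    then show ?thesis
      unfolding V_def d[OF un] by (rule det_row_exchange[OF len p(1), of d "\<lambda>k w. w powi (- (int k + 1))"])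
  qed
  have Q0: "Q v \<noteq> 0" "Q u \<noteq> 0"
    using fin uR by (auto simp: Q_def)
  \<comment> \<open>As \<open>e\<close> is minus the logarithmic derivative at \<open>v\<close>, its
    product with \<open>v ^ N * (v + 1) ^ (L - N)\<close> is minus the derivative found in
    \<open>qzL_qzR_deriv\<close>.\<close>
  have e0: "e \<noteq> 0" and qL: "qzL N L z v * Q v = - e * v ^ N * (v + 1) ^ (L - N)"
  proof -
    have e: "e = - (of_nat N + of_nat L * v) / (v * (v + 1))"
      using R_bound(2)[OF v] v1 by (simp add: e_def divide_simps)
    show "e \<noteq> 0"
      using qz_root_simple(1)[OF N z assms(4), of v] v R_bound(2)[OF v] v1
      by (simp only: e right_roots_def mem_Collect_eq divide_eq_0_iff neg_equal_0_iff_equal mult_eq_0_iff simp_thms)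
    obtain n m where nm: "N = Suc n" "L - N = Suc m"
      using N by (metis Suc_pred zero_less_diff)
    then have pow: "v ^ N = v * v ^ (N - 1)" "(v + 1) ^ (L - N) = (v + 1) * (v + 1) ^ (L - N - 1)"
      by simp_all
    have num: "of_nat N + of_nat L * v = - e * (v * (v + 1))"
      using R_bound(2)[OF v] v1 by (simp add: e)
    show "qzL N L z v * Q v = - e * v ^ N * (v + 1) ^ (L - N)"
      unfolding Q_def qzL_qzR_deriv[OF N z assms(4) v] pow num by (simp only: mult_ac)
  qed
  have qR: "qzR N L z u = (u - v) * Q u"
    unfolding qzR_def Q_def using prod.remove[OF fin v] .
  have "u \<noteq> v"
    using uR v by auto
  have A_eq: "A ?ws = pch N Y \<rho> v u * A ws / e"
    unfolding A'[symmetric] using e0 by simp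
  have "V ?ws = (Q v / v ^ N * V ?ws) * v ^ N / Q v"
    using Q0(1) R_bound(2)[OF v] by simp
  then have V_eq: "V ?ws = Q u / u ^ N * V ws * v ^ N / Q v"
    unfolding V' .
  have "pch_norm N L Y v u z
      = qzL N L z v * ((u - v) * Q u) / (u ^ N * (v + 1) ^ (L - N))
        * ((pch N Y \<rho> v u * A ws / e) / (Q u / u ^ N * V ws * v ^ N / Q v) / ((v - u) * (A ws / V ws)))"
    unfolding pch_norm_def pch_mod_def GY A_eq V_eq qR ..
  also have "\<dots> = - (qzL N L z v * Q v) / (e * v ^ N * (v + 1) ^ (L - N)) * pch N Y \<rho> v u"
  proof -
    \<comment> \<open>The sign from \<open>v - u = - (u - v)\<close> is later absorbed by the one in
      \<open>qL\<close>.\<close>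
    have cancel: "l * (d * q) / (x * w) * ((c * a / e) / (q / x * b * y / r) / (- d * (a / b))) = - (l * r) / (e * y * w) * c"
      if "d \<noteq> 0" "q \<noteq> 0" "x \<noteq> 0" "a \<noteq> 0" "b \<noteq> 0" "r \<noteq> 0" for d q x a b r l w c y :: complex
      using that by (simp add: mult_ac)
    have "u - v \<noteq> 0" "u ^ N \<noteq> 0"
      using \<open>u \<noteq> v\<close> un by simp_all
    from cancel[of "u - v" "Q u" "u ^ N" "A ws" "V ws" "Q v" "qzL N L z v" "(v + 1) ^ (L - N)"
        "pch N Y \<rho> v u" "v ^ N", OF this(1) Q0(2) this(2) nz Q0(1)]
    show ?thesis
      unfolding minus_diff_eq .
  qed
  also have "\<dots> = pch N Y \<rho> v u"
    unfolding qL using e0 v1 R_bound(2)[OF v] by simp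
  finally show "pch_norm N L Y v u z = pch N Y \<rho> v u" .
qed

end
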